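(* Let $H$ be a complex separable Hilbert space with $\dim H\geq 3$, and let $PI(H)$ be the set of all partial isometries on $H$. Suppose that $\phi: PI(H)\to PI(H)$ is a bijective transformation which preserves the partial ordering and the orthogonality between partial isometries in both directions, i.e., for all $P,Q\in PI(H)$, $P\leq Q$ if and only if $\phi(P)\leq\phi(Q)$, and $P$ is orthogonal to $Q$ if and only if $\phi(P)$ is orthogonal to $\phi(Q)$. If $\phi$ is continuous (in the operator norm) at a single element of $PI(H)$ different from $0$ (that is, there is at least one $R_0\in PI(H)$, $R_0\neq 0$, at which $\phi$ is continuous with respect to the operator norm), then $\phi$ can be written in one of the following forms: (i) there exist unitaries $U,V$ on $H$ such that $\phi(R)=URV$ for all $R\in PI(H)$; (ii) there exist antiunitaries $U,V$ on $H$ such that $\phi(R)=URV$ for all $R\in PI(H)$; (iii) there exist unitaries $U,V$ on $H$ such that $\phi(R)=UR^*V$ for all $R\in PI(H)$; (iv) there exist antiunitaries $U,V$ on $H$ such that $\phi(R)=UR^*V$ for all $R\in PI(H)$.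
   Context: $B(H)$ denotes the algebra of all bounded linear operators on $H$. An operator $U\in B(H)$ is called a partial isometry if there is a closed subspace $I_U$ of $H$, called the initial space of $U$, such that $U$ acts as an isometry on $I_U$ and $U$ is zero on $I_U^\perp$. The range of $U$ is called the final space of $U$ and is denoted by $F_U$. The set of all partial isometries on $H$ is denoted by $PI(H)$. Partial ordering on $PI(H)$: for $P,Q\in PI(H)$, write $P\leq Q$ if $I_P\subset I_Q$, $F_P\subset F_Q$ and $P_{|I_P}=Q_{|I_P}$. Orthogonality: $P\in PI(H)$ is orthogonal to $Q\in PI(H)$ if $P^*Q=PQ^*=0$. A unitary operator is a linear norm preserving bijection on $H$; an antiunitary operator is a conjugate-linear norm preserving bijection on $H$. $R^*$ denotes the Hilbert space adjoint of $R$. *)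

theory Defs
  imports "HOL-Analysis.Analysis"
begin

class complex_vector = real_vector +
  fixes scaleC :: "complex \<Rightarrow> 'a \<Rightarrow> 'a"  (infixr \<open>*\<^sub>C\<close> 75)
  assumes scaleC_add_right: "a *\<^sub>C (x + y) = a *\<^sub>C x + a *\<^sub>C y"
    and scaleC_add_left: "(a + b) *\<^sub>C x = a *\<^sub>C x + b *\<^sub>C x"
    and scaleC_scaleC: "a *\<^sub>C b *\<^sub>C x = (a * b) *\<^sub>C x"
    and scaleC_one: "1 *\<^sub>C x = x"
    and scaleR_scaleC: "r *\<^sub>R x = complex_of_real r *\<^sub>C x"

global_interpretation complex_vector: vector_space "scaleC :: complex \<Rightarrow> 'a \<Rightarrow> 'a::complex_vector"
  defines csubspace = complex_vector.subspace
    and cspan = complex_vector.span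
  by unfold_locales (rule scaleC_add_right scaleC_add_left scaleC_scaleC scaleC_one)+

text \<open>
  The underlying real inner product is the real part of the complex one, so that the norm inherited
  from \<^class>\<open>real_inner\<close> is the usual one, \<open>norm x = sqrt (Re (cinner x x))\<close>. Positive
  definiteness of \<open>cinner\<close> likewise comes from \<^class>\<open>real_inner\<close>.
\<close>

class complex_inner = complex_vector + real_inner +
  fixes cinner :: "'a \<Rightarrow> 'a \<Rightarrow> complex"
  assumes cinner_commute: "cinner x y = cnj (cinner y x)"
    and cinner_add_left: "cinner (x + y) z = cinner x z + cinner y z"
    and cinner_scaleC_left: "cinner (c *\<^sub>C x) y = c * cinner x y"
    and inner_eq_Re_cinner: "inner x y = Re (cinner x y)"

class chilbert_space = complex_inner + complete_space

definition corthogonal_comp :: "'a::complex_inner set \<Rightarrow> 'a set" where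
  "corthogonal_comp S = {x. \<forall>y\<in>S. cinner x y = 0}"

definition orthonormal_basis :: "'a::complex_inner set \<Rightarrow> bool" where
  "orthonormal_basis B \<longleftrightarrow>
    (\<forall>x\<in>B. norm x = 1) \<and>
    (\<forall>x\<in>B. \<forall>y\<in>B. x \<noteq> y \<longrightarrow> cinner x y = 0) \<and>
    closure (cspan B) = UNIV"

definition hilbert_dim_ge :: "'a::chilbert_space itself \<Rightarrow> nat \<Rightarrow> bool" where
  "hilbert_dim_ge _ n \<longleftrightarrow>
    (\<exists>B::'a set. orthonormal_basis B \<and> (infinite B \<or> n \<le> card B))"

text \<open>
  The type \<^typ>\<open>'a \<Rightarrow>\<^sub>L 'a\<close> consists of the bounded \<^emph>\<open>real\<close>-linear operators, with the
  operator norm. Elements of \<open>B(H)\<close> are the complex-linear ones among them; antiunitaries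
  also live in this type.
\<close>

definition complex_linear_op :: "('a::complex_inner \<Rightarrow>\<^sub>L 'a) \<Rightarrow> bool" where
  "complex_linear_op R \<longleftrightarrow> Vector_Spaces.linear scaleC scaleC (blinfun_apply R)"

definition conjugate_linear_op :: "('a::complex_inner \<Rightarrow>\<^sub>L 'a) \<Rightarrow> bool" where
  "conjugate_linear_op R \<longleftrightarrow>
    (\<forall>x y. R (x + y) = R x + R y) \<and> (\<forall>c x. R (c *\<^sub>C x) = cnj c *\<^sub>C R x)"

definition unitary :: "('a::complex_inner \<Rightarrow>\<^sub>L 'a) \<Rightarrow> bool" where
  "unitary U \<longleftrightarrow> complex_linear_op U \<and> (\<forall>x. norm (U x) = norm x) \<and> bij (blinfun_apply U)"

definition antiunitary :: "('a::complex_inner \<Rightarrow>\<^sub>L 'a) \<Rightarrow> bool" where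
  "antiunitary U \<longleftrightarrow> conjugate_linear_op U \<and> (\<forall>x. norm (U x) = norm x) \<and> bij (blinfun_apply U)"

text \<open>
  The adjoint exists, uniquely, for every complex-linear bounded operator; it is only
  applied to such operators.
\<close>

definition hadjoint :: "('a::chilbert_space \<Rightarrow>\<^sub>L 'a) \<Rightarrow> ('a \<Rightarrow>\<^sub>L 'a)" where
  "hadjoint R = (THE S :: 'a \<Rightarrow>\<^sub>L 'a. \<forall>x y. cinner (R x) y = cinner x (S y))"

definition is_initial_space :: "('a::chilbert_space \<Rightarrow>\<^sub>L 'a) \<Rightarrow> 'a set \<Rightarrow> bool" where
  "is_initial_space U I \<longleftrightarrow>
    csubspace I \<and> closed I \<and> (\<forall>x\<in>I. norm (U x) = norm x) \<and> (\<forall>x\<in>corthogonal_comp I. U x = 0)"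

definition partial_isometries :: "('a::chilbert_space \<Rightarrow>\<^sub>L 'a) set" where
  "partial_isometries = {U. complex_linear_op U \<and> (\<exists>I. is_initial_space U I)}"

text \<open>
  For a partial isometry the initial space is unique (it is the orthogonal complement of the
  kernel), so the description below is meaningful.
\<close>

definition initial_space :: "('a::chilbert_space \<Rightarrow>\<^sub>L 'a) \<Rightarrow> 'a set" where
  "initial_space U = (THE I. is_initial_space U I)"

definition final_space :: "('a::chilbert_space \<Rightarrow>\<^sub>L 'a) \<Rightarrow> 'a set" where
  "final_space U = range (blinfun_apply U)"

definition pi_le :: "('a::chilbert_space \<Rightarrow>\<^sub>L 'a) \<Rightarrow> ('a \<Rightarrow>\<^sub>L 'a) \<Rightarrow> bool" where
  "pi_le P Q \<longleftrightarrow>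
    initial_space P \<subseteq> initial_space Q \<and> final_space P \<subseteq> final_space Q \<and>
    (\<forall>x\<in>initial_space P. P x = Q x)"

definition pi_orthogonal :: "('a::chilbert_space \<Rightarrow>\<^sub>L 'a) \<Rightarrow> ('a \<Rightarrow>\<^sub>L 'a) \<Rightarrow> bool" where
  "pi_orthogonal P Q \<longleftrightarrow> hadjoint P o\<^sub>L Q = 0 \<and> P o\<^sub>L hadjoint Q = 0"

end

theory Submission
  imports Defs
begin

text \<open>
  Write \<open>[e, f]\<close> for the operator \<open>x \<mapsto> \<langle>x, f\<rangle> e\<close> with unit vectors \<open>e\<close> and \<open>f\<close>. These are the minimal nonzero
  partial isometries, and \<open>[e, f] \<le> R\<close> means \<open>R f = e\<close>; so \<open>R\<close> is determined by the \<open>[e, f]\<close> below it, and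
  it suffices to know \<open>\<phi>\<close> on rank-one operators. On these, the given structure reads as follows: \<open>[e, f]\<close>
  is orthogonal to \<open>[g, h]\<close> iff \<open>e \<bottom> g\<close> and \<open>f \<bottom> h\<close>, and the two have a common upper bound iff
  \<open>\<langle>e, g\<rangle> = \<langle>f, h\<rangle>\<close> (\<open>rank1_compatible_iff\<close>).

  Orthogonality recovers the grid structure of the rank-one operators: \<open>[e, f]\<close> and \<open>[g, h]\<close> have the same
  range or the same initial space iff their double orthogonal complement contains no orthogonal pair
  (\<open>share_line_iff\<close>; here three dimensions are needed). A bijection of a grid that preserves the
  relation of lying in a common row or column either maps rows to rows and columns to columns or
  exchanges rows and columns (\<open>straight_cases\<close>). The exchange is what the adjoint does, so assume the
  former. Then, up to phases, \<open>\<phi> [e, f] = [U e, V f]\<close> for two maps \<open>U\<close>, \<open>V\<close> of the unit sphere.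

  The relation \<open>\<langle>e, g\<rangle> = \<langle>f, h\<rangle>\<close> controls everything else. Since any two of the projections \<open>[e, e]\<close> have
  an upper bound, \<open>U\<close> and \<open>V\<close> can be chosen with equal Gram matrices. The remaining phase factor \<open>c e f\<close>
  is a multiplicative cocycle whose defect is invariant under moving its three arguments with equal
  nonzero inner products; moving them to one point shows that the defect, and after normalization
  \<open>c\<close> itself, is trivial (\<open>cocycle_identity\<close>, \<open>straight_factor\<close>). Therefore \<open>\<langle>U e, U f\<rangle>\<close> depends on \<open>\<langle>e, f\<rangle>\<close>
  only, say through \<open>k\<close>. Expanding in three orthonormal vectors gives a functional equation that leaves
  for \<open>k\<close> only the identity and complex conjugation (\<open>inner_product_function\<close>, \<open>gram_map_rigid\<close>). So \<open>U\<close> and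
  \<open>V\<close> extend to two unitary or two antiunitary operators, and \<open>\<phi> R = U R V\<^sup>-\<^sup>1\<close> because both sides
  dominate the same rank-one operators.
\<close>

section \<open>Complex inner product spaces\<close>

lemma cinner_add_right: "cinner x (y + z) = cinner x y + cinner x z"
  for x y z :: "'a::complex_inner"
  by (metis cinner_add_left cinner_commute complex_cnj_add)

lemma cinner_scaleC_right: "cinner x (c *\<^sub>C y) = cnj c * cinner x y"
  for x y :: "'a::complex_inner"
  by (metis cinner_commute cinner_scaleC_left complex_cnj_mult)

lemma cinner_zero_left [simp]: "cinner 0 y = 0" for y :: "'a::complex_inner"
  using cinner_add_left[of 0 0 y] by simp

lemma cinner_zero_right [simp]: "cinner y 0 = 0" for y :: "'a::complex_inner"
  using cinner_add_right[of y 0 0] by simp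

lemma cinner_minus_left: "cinner (- x) y = - cinner x y" for x y :: "'a::complex_inner"
  using cinner_add_left[of x "- x" y] by (simp add: eq_neg_iff_add_eq_0 add.commute)

lemma cinner_minus_right: "cinner x (- y) = - cinner x y" for x y :: "'a::complex_inner"
  using cinner_add_right[of x y "- y"] by (simp add: eq_neg_iff_add_eq_0 add.commute)

lemma cinner_diff_left: "cinner (x - z) y = cinner x y - cinner z y"
  for x y z :: "'a::complex_inner"
  using cinner_add_left[of x "- z" y] by (simp add: cinner_minus_left)

lemma cinner_diff_right: "cinner y (x - z) = cinner y x - cinner y z"
  for x y z :: "'a::complex_inner"
  using cinner_add_right[of y x "- z"] by (simp add: cinner_minus_right)

lemmas cinner_simps = cinner_add_left cinner_add_right cinner_diff_left cinner_diff_right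
  cinner_scaleC_left cinner_scaleC_right cinner_minus_left cinner_minus_right

lemma cinner_self: "cinner x x = complex_of_real ((norm x)\<^sup>2)" for x :: "'a::complex_inner"
proof -
  have "Im (cinner x x) = 0"
    using cinner_commute[of x x] by (metis add.inverse_neutral cnj.simps(2) equal_neg_zero)
  moreover have "Re (cinner x x) = (norm x)\<^sup>2"
    by (metis inner_eq_Re_cinner power2_norm_eq_inner)
  ultimately show ?thesis by (simp add: complex_eq_iff)
qed

lemma cinner_self_unit: "norm x = 1 \<Longrightarrow> cinner x x = 1" for x :: "'a::complex_inner"
  by (simp add: cinner_self)

lemma cinner_eq_0_commute: "cinner x y = 0 \<longleftrightarrow> cinner y x = 0" for x y :: "'a::complex_inner"
  by (metis cinner_commute complex_cnj_zero)

lemma scaleC_zero_left [simp]: "0 *\<^sub>C x = 0" for x :: "'a::complex_vector"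
  by (metis of_real_0 scaleR_scaleC scaleR_zero_left)

lemma scaleC_zero_right [simp]: "c *\<^sub>C (0 :: 'a::complex_vector) = 0"
  by (fact complex_vector.scale_zero_right)

lemma scaleC_one' [simp]: "1 *\<^sub>C x = x" for x :: "'a::complex_vector"
  by (fact scaleC_one)

lemma norm_sq_Re_cinner: "(norm x)\<^sup>2 = Re (cinner x x)" for x :: "'a::complex_inner"
  by (simp add: cinner_self flip: of_real_power)

lemma norm_scaleC: "norm (c *\<^sub>C x) = cmod c * norm x" for x :: "'a::complex_inner"
proof -
  have "cinner (c *\<^sub>C x) (c *\<^sub>C x) = (c * cnj c) * cinner x x"
    by (simp add: cinner_simps)
  also have "\<dots> = complex_of_real ((cmod c)\<^sup>2) * of_real ((norm x)\<^sup>2)"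
    by (simp only: complex_norm_square[symmetric] cinner_self)
  finally have "cinner (c *\<^sub>C x) (c *\<^sub>C x) = complex_of_real ((cmod c)\<^sup>2) * of_real ((norm x)\<^sup>2)" .
  then have "(norm (c *\<^sub>C x))\<^sup>2 = (cmod c * norm x)\<^sup>2"
    by (simp add: norm_sq_Re_cinner[of "c *\<^sub>C x"] power_mult_distrib flip: of_real_power of_real_mult)
  then show ?thesis by (simp add: power2_eq_iff_nonneg)
qed

lemma norm_sgn_unit: "x \<noteq> 0 \<Longrightarrow> norm (sgn x) = 1" for x :: "'a::complex_inner"
  by (simp add: norm_sgn)

lemma sgn_scaleC: "sgn x = complex_of_real (inverse (norm x)) *\<^sub>C x" for x :: "'a::complex_inner"
  by (simp add: sgn_div_norm scaleR_scaleC)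

lemma cinner_sgn_left: "cinner (sgn x) y = of_real (inverse (norm x)) * cinner x y"
  and cinner_sgn_right: "cinner y (sgn x) = of_real (inverse (norm x)) * cinner y x"
  for x y :: "'a::complex_inner"
  by (simp_all add: sgn_scaleC cinner_scaleC_left cinner_scaleC_right)

text \<open>Bessel's identity for a single unit vector; it contains the Cauchy-Schwarz inequality
  together with its case of equality.\<close>

lemma norm_residual:
  fixes x y :: "'a::complex_inner"
  assumes "norm y = 1"
  shows "(norm (x - cinner x y *\<^sub>C y))\<^sup>2 = (norm x)\<^sup>2 - (cmod (cinner x y))\<^sup>2"
proof -
  have "cinner (x - cinner x y *\<^sub>C y) (x - cinner x y *\<^sub>C y)
      = cinner x x - complex_of_real ((cmod (cinner x y))\<^sup>2)"
    unfolding complex_norm_square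
    by (simp add: cinner_simps cinner_self_unit[OF assms] cinner_commute[of y x])
  then show ?thesis
    unfolding norm_sq_Re_cinner by (simp flip: of_real_power)
qed

lemma cauchy_schwarz: "cmod (cinner x y) \<le> norm x * norm y" for x y :: "'a::complex_inner"
proof (cases "y = 0")
  case False
  define u where "u = sgn y"
  have u: "norm u = 1" using False by (simp add: u_def norm_sgn)
  have y: "y = complex_of_real (norm y) *\<^sub>C u"
    by (simp add: u_def sgn_div_norm scaleR_scaleC[symmetric] False)
  have "(cmod (cinner x u))\<^sup>2 \<le> (norm x)\<^sup>2"
    using norm_residual[OF u, of x] zero_le_power2[of "norm (x - cinner x u *\<^sub>C u)"] by linarith
  then have le: "cmod (cinner x u) \<le> norm x" using norm_ge_zero by (rule power2_le_imp_le)
  have "cinner x y = of_real (norm y) * cinner x u"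
    using arg_cong[OF y, of "cinner x"] unfolding cinner_scaleC_right by simp
  then show ?thesis using mult_right_mono[OF le norm_ge_zero[of y]] by (simp add: norm_mult mult.commute)
qed simp

lemma eq_cinner_scaleC:
  fixes x y :: "'a::complex_inner"
  assumes "norm y = 1" and "cmod (cinner x y) = norm x"
  shows "x = cinner x y *\<^sub>C y"
  using norm_residual[OF assms(1), of x] assms(2) by simp

lemma unit_eq_of_cinner_1:
  fixes x y :: "'a::complex_inner"
  assumes "norm y = 1" "norm x \<le> 1" "cinner x y = 1"
  shows "x = y"
proof -
  have "norm x = 1" using cauchy_schwarz[of x y] assms by simp
  then show ?thesis using eq_cinner_scaleC[OF assms(1), of x] assms by simp
qed

lemma norm_add_orthogonal:
  fixes x y :: "'a::complex_inner"
  assumes "cinner x y = 0"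
  shows "(norm (x + y))\<^sup>2 = (norm x)\<^sup>2 + (norm y)\<^sup>2"
proof -
  have "cinner (x + y) (x + y) = cinner x x + cinner y y"
    using assms cinner_eq_0_commute[of x y] by (simp add: cinner_simps)
  then show ?thesis by (simp add: norm_sq_Re_cinner)
qed

lemma cinner_ext: "(\<And>z. cinner x z = cinner y z) \<Longrightarrow> x = y" for x y :: "'a::complex_inner"
  using cinner_self[of "x - y"] by (simp add: cinner_diff_left)

lemma cinner_ext_right: "(\<And>z. cinner z x = cinner z y) \<Longrightarrow> x = y" for x y :: "'a::complex_inner"
  by (metis cinner_commute cinner_ext)

lemma bounded_linear_cinner_left: "bounded_linear (\<lambda>x. cinner x y)" for y :: "'a::complex_inner"
  by (rule bounded_linear_intro[where K = "norm y"])
     (auto simp: cinner_simps scaleR_scaleC scaleR_conv_of_real cauchy_schwarz)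

lemma bounded_linear_scaleC: "bounded_linear (\<lambda>c. c *\<^sub>C e)" for e :: "'a::complex_inner"
  by (rule bounded_linear_intro[where K = "norm e"])
     (auto simp: scaleC_add_left scaleR_scaleC scaleC_scaleC norm_scaleC scaleR_conv_of_real)

text \<open>Additivity and boundedness are built into the type, so only complex homogeneity remains.\<close>

lemma complex_linear_op_iff:
  "complex_linear_op R \<longleftrightarrow> (\<forall>c x. R (c *\<^sub>C x) = c *\<^sub>C R x)"
proof
  assume "complex_linear_op R"
  then interpret Vector_Spaces.linear scaleC scaleC "blinfun_apply R"
    by (simp add: complex_linear_op_def)
  show "\<forall>c x. R (c *\<^sub>C x) = c *\<^sub>C R x" by (simp add: scale)
next
  assume "\<forall>c x. R (c *\<^sub>C x) = c *\<^sub>C R x"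
  then show "complex_linear_op R"
    unfolding complex_linear_op_def
    by unfold_locales (auto simp: blinfun.add_right scaleC_add_right scaleC_add_left scaleC_scaleC)
qed

lemma csubspaceI:
  assumes "0 \<in> S" "\<And>x y. x \<in> S \<Longrightarrow> y \<in> S \<Longrightarrow> x + y \<in> S" "\<And>c x. x \<in> S \<Longrightarrow> c *\<^sub>C x \<in> S"
  shows "csubspace S"
  using assms by (auto simp: complex_vector.subspace_def)

lemma csubspaceD:
  assumes "csubspace S"
  shows "0 \<in> S" "x \<in> S \<Longrightarrow> y \<in> S \<Longrightarrow> x + y \<in> S" "x \<in> S \<Longrightarrow> y \<in> S \<Longrightarrow> x - y \<in> S"
    "x \<in> S \<Longrightarrow> c *\<^sub>C x \<in> S" "x \<in> S \<Longrightarrow> r *\<^sub>R x \<in> S"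
  using assms complex_vector.subspace_diff[OF assms]
  by (auto simp: complex_vector.subspace_def scaleR_scaleC)

lemma parallelogram:
  "(norm (x - y))\<^sup>2 = 2 * (norm x)\<^sup>2 + 2 * (norm y)\<^sup>2 - (norm (x + y))\<^sup>2"
  for x y :: "'a::real_inner"
  by (simp add: power2_norm_eq_inner inner_simps inner_commute)

text \<open>A minimising sequence for the distance from \<open>x\<close> to \<open>M\<close> is Cauchy by the parallelogram law,
  because midpoints of elements of \<open>M\<close> stay in \<open>M\<close>.\<close>

lemma nearest_point:
  fixes M :: "'a::chilbert_space set"
  assumes M: "csubspace M" "closed M"
  shows "\<exists>m\<in>M. \<forall>y\<in>M. norm (x - m) \<le> norm (x - y)"
proof -
  define d where "d = (INF y\<in>M. norm (x - y))"
  have ne: "M \<noteq> {}" using csubspaceD(1)[OF M(1)] by auto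
  have bdd: "bdd_below ((\<lambda>y. norm (x - y)) ` M)" by (rule bdd_belowI[of _ 0]) auto
  have dle: "d \<le> norm (x - y)" if "y \<in> M" for y
    unfolding d_def by (rule cINF_lower[OF bdd that])
  have d0: "0 \<le> d" unfolding d_def by (rule cINF_greatest[OF ne]) auto
  have "\<exists>y\<in>M. norm (x - y) < d + inverse (real (Suc n))" for n
    using cINF_less_iff[OF ne bdd, of "d + inverse (real (Suc n))"] by (simp add: d_def)
  then obtain y where yM: "\<And>n. y n \<in> M" and y: "\<And>n. norm (x - y n) < d + inverse (real (Suc n))"
    by metis
  have lim: "(\<lambda>n. norm (x - y n)) \<longlonglongrightarrow> d"
  proof (rule tendsto_sandwich)
    show "\<forall>\<^sub>F n in sequentially. d \<le> norm (x - y n)" using dle[OF yM] by simp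
    show "\<forall>\<^sub>F n in sequentially. norm (x - y n) \<le> d + inverse (real (Suc n))"
      using y less_imp_le by (intro always_eventually) blast
    show "(\<lambda>n. d) \<longlonglongrightarrow> d" by simp
    show "(\<lambda>n. d + inverse (real (Suc n))) \<longlonglongrightarrow> d"
      using tendsto_add[OF tendsto_const LIMSEQ_inverse_real_of_nat, of d] by simp
  qed
  have mid: "(norm (y m - y n))\<^sup>2 \<le> 2 * (norm (x - y m))\<^sup>2 + 2 * (norm (x - y n))\<^sup>2 - 4 * d\<^sup>2" for m n
  proof -
    have "(1/2) *\<^sub>R (y m + y n) \<in> M" by (intro csubspaceD(5)[OF M(1)] csubspaceD(2)[OF M(1)] yM)
    then have "d \<le> norm (x - (1/2) *\<^sub>R (y m + y n))" by (rule dle)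
    also have "x - (1/2) *\<^sub>R (y m + y n) = (1/2) *\<^sub>R ((x - y m) + (x - y n))"
    proof -
      have "(1/2) *\<^sub>R ((x - y m) + (x - y n)) = (1/2) *\<^sub>R (x + x) - (1/2) *\<^sub>R (y m + y n)"
        unfolding scaleR_diff_right[symmetric] by (simp add: algebra_simps)
      then show ?thesis by simp
    qed
    finally have "2 * d \<le> norm ((x - y m) + (x - y n))" by simp
    then have "(2 * d)\<^sup>2 \<le> (norm ((x - y m) + (x - y n)))\<^sup>2"
      using d0 by (intro power_mono) auto
    then show ?thesis
      using parallelogram[of "x - y n" "x - y m"]
      by (simp add: power_mult_distrib add.commute)
  qed
  have "Cauchy y"
  proof (rule metric_CauchyI)
    fix e :: real assume e: "0 < e"
    have "(\<lambda>n. (norm (x - y n))\<^sup>2) \<longlonglongrightarrow> d\<^sup>2" by (intro tendsto_intros lim)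
    moreover have "d\<^sup>2 < d\<^sup>2 + e\<^sup>2 / 4" using e by simp
    ultimately have "\<forall>\<^sub>F n in sequentially. (norm (x - y n))\<^sup>2 < d\<^sup>2 + e\<^sup>2 / 4"
      by (rule order_tendstoD)
    then obtain N where N: "\<And>n. n \<ge> N \<Longrightarrow> (norm (x - y n))\<^sup>2 < d\<^sup>2 + e\<^sup>2 / 4"
      by (auto simp: eventually_sequentially)
    have "dist (y m) (y n) < e" if "m \<ge> N" "n \<ge> N" for m n
    proof -
      have "(norm (y m - y n))\<^sup>2 < e\<^sup>2"
        using mid[of m n] N[OF that(1)] N[OF that(2)] by linarith
      then show ?thesis using e by (simp add: dist_norm power_less_imp_less_base)
    qed
    then show "\<exists>N. \<forall>m\<ge>N. \<forall>n\<ge>N. dist (y m) (y n) < e" by blast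
  qed
  then obtain m where m: "y \<longlonglongrightarrow> m" using Cauchy_convergent convergent_def by blast
  have "m \<in> M" using closed_sequentially[OF M(2) yM m] .
  moreover have "norm (x - m) = d"
    using LIMSEQ_unique[OF tendsto_norm[OF tendsto_diff[OF tendsto_const m]] lim] .
  ultimately show ?thesis using dle by metis
qed

text \<open>Moving the nearest point along a unit vector of \<open>M\<close> cannot decrease the distance to \<open>x\<close>;
  by Bessel's identity the residual is then orthogonal to that vector.\<close>

lemma projection_theorem:
  fixes M :: "'a::chilbert_space set"
  assumes M: "csubspace M" "closed M"
  obtains i j where "x = i + j" "i \<in> M" "j \<in> corthogonal_comp M"
proof -
  obtain m where m: "m \<in> M" "\<And>y. y \<in> M \<Longrightarrow> norm (x - m) \<le> norm (x - y)"
    using nearest_point[OF M] by blast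
  have "cinner (x - m) y = 0" if y: "y \<in> M" for y
  proof (cases "y = 0")
    case False
    define u where "u = sgn y"
    have u: "norm u = 1" "u \<in> M"
      using False csubspaceD(5)[OF M(1) y] by (auto simp: u_def norm_sgn sgn_div_norm)
    define r where "r = cinner (x - m) u"
    have "norm (x - m) \<le> norm (x - (m + r *\<^sub>C u))"
      by (intro m csubspaceD(2,4)[OF M(1)] u)
    then have "(norm (x - m))\<^sup>2 \<le> (norm ((x - m) - r *\<^sub>C u))\<^sup>2"
      by (intro power_mono) (auto simp: diff_diff_eq)
    then have "r = 0" using norm_residual[OF u(1), of "x - m"] by (simp add: r_def)
    then show ?thesis
      by (simp add: r_def u_def sgn_scaleC cinner_simps False)
  qed simp
  then show ?thesis using that[of m "x - m"] m(1) by (simp add: corthogonal_comp_def)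
qed

section \<open>Partial isometries and their order\<close>

text \<open>If \<open>x = i + j\<close> is split along \<open>I\<close>, then \<open>U\<close> only sees \<open>i\<close>, so \<open>U\<close> preserves the norm of \<open>x\<close>
  exactly when \<open>j = 0\<close>. This description of the initial space contains no choice, and all later
  arguments use it instead of the space itself.\<close>

lemma is_initial_space_unique:
  fixes U :: "'a::chilbert_space \<Rightarrow>\<^sub>L 'a"
  assumes "is_initial_space U I"
  shows "I = {x. norm (U x) = norm x}"
proof -
  from assms have I: "csubspace I" "closed I" and iso: "\<And>x. x \<in> I \<Longrightarrow> norm (U x) = norm x"
    and ker: "\<And>x. x \<in> corthogonal_comp I \<Longrightarrow> U x = 0"
    by (auto simp: is_initial_space_def)
  have "x \<in> I" if x: "norm (U x) = norm x" for x
  proof -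
    obtain i j where ij: "x = i + j" "i \<in> I" "j \<in> corthogonal_comp I"
      using projection_theorem[OF I] by blast
    have "norm x = norm i" using x ij iso[of i] ker[of j] by (simp add: blinfun.add_right)
    moreover have "cinner i j = 0"
      using ij(2,3) by (auto simp: corthogonal_comp_def cinner_eq_0_commute)
    ultimately have "j = 0" using norm_add_orthogonal[of i j] ij(1) by simp
    then show ?thesis using ij by simp
  qed
  then show ?thesis using iso by auto
qed

lemma initial_space_eq:
  fixes P :: "'a::chilbert_space \<Rightarrow>\<^sub>L 'a"
  assumes "P \<in> partial_isometries"
  shows "initial_space P = {x. norm (P x) = norm x}"
    and "is_initial_space P {x. norm (P x) = norm x}"
proof -
  obtain I where I: "is_initial_space P I" using assms by (auto simp: partial_isometries_def)
  have eq: "J = {x. norm (P x) = norm x}" if "is_initial_space P J" for J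
    using is_initial_space_unique[OF that] .
  show "is_initial_space P {x. norm (P x) = norm x}" using I eq[OF I] by simp
  then show "initial_space P = {x. norm (P x) = norm x}"
    unfolding initial_space_def by (rule the_equality) (rule eq)
qed

lemma partial_isometryI:
  fixes P :: "'a::chilbert_space \<Rightarrow>\<^sub>L 'a"
  assumes "\<And>c x. P (c *\<^sub>C x) = c *\<^sub>C P x" "csubspace I" "closed I"
    "\<And>x. x \<in> I \<Longrightarrow> norm (P x) = norm x" "\<And>x. x \<in> corthogonal_comp I \<Longrightarrow> P x = 0"
  shows "P \<in> partial_isometries"
  using assms by (auto simp: partial_isometries_def complex_linear_op_iff is_initial_space_def)

lemma partial_isometry_scaleC:
  "P \<in> partial_isometries \<Longrightarrow> P (c *\<^sub>C x) = c *\<^sub>C P x" for P :: "'a::chilbert_space \<Rightarrow>\<^sub>L 'a"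
  by (simp add: partial_isometries_def complex_linear_op_iff)

lemma partial_isometry_decompose:
  fixes P :: "'a::chilbert_space \<Rightarrow>\<^sub>L 'a"
  assumes "P \<in> partial_isometries"
  obtains i j where "x = i + j" "norm (P i) = norm i" "P j = 0"
    "\<And>y. norm (P y) = norm y \<Longrightarrow> cinner j y = 0"
proof -
  let ?I = "{x. norm (P x) = norm x}"
  have I: "is_initial_space P ?I" by (rule initial_space_eq(2)[OF assms])
  then obtain i j where "x = i + j" "i \<in> ?I" "j \<in> corthogonal_comp ?I"
    using projection_theorem[of ?I x] by (auto simp: is_initial_space_def)
  then show ?thesis using that I by (auto simp: corthogonal_comp_def is_initial_space_def)
qed

lemma Re_cinner_polarization:
  "Re (cinner x y) = ((norm (x + y))\<^sup>2 - (norm x)\<^sup>2 - (norm y)\<^sup>2) / 2" for x y :: "'a::complex_inner"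
  by (simp add: inner_eq_Re_cinner[symmetric] power2_norm_eq_inner inner_simps inner_commute)

lemma Im_cinner_eq: "Im (cinner x y) = Re (cinner x (\<i> *\<^sub>C y))" for x y :: "'a::complex_inner"
  by (simp add: cinner_simps)

text \<open>Polarization proves this for two vectors of the initial space, and the component of \<open>y\<close>
  outside the initial space contributes nothing to either side.\<close>

lemma partial_isometry_cinner:
  fixes P :: "'a::chilbert_space \<Rightarrow>\<^sub>L 'a"
  assumes P: "P \<in> partial_isometries" and x: "norm (P x) = norm x"
  shows "cinner (P x) (P y) = cinner x y"
proof -
  let ?I = "{x. norm (P x) = norm x}"
  have I: "csubspace ?I" using initial_space_eq(2)[OF P] by (simp add: is_initial_space_def)
  have re: "Re (cinner (P x) (P z)) = Re (cinner x z)" if z: "z \<in> ?I" for z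
    using csubspaceD(2)[OF I, of x z] x z
    by (simp add: Re_cinner_polarization blinfun.add_right[symmetric])
  have eq: "cinner (P x) (P z) = cinner x z" if z: "z \<in> ?I" for z
    using re[OF z] re[OF csubspaceD(4)[OF I z, of \<i>]]
    by (simp add: complex_eq_iff Im_cinner_eq partial_isometry_scaleC[OF P])
  obtain i j where ij: "y = i + j" "norm (P i) = norm i" "P j = 0" "cinner j x = 0"
    using partial_isometry_decompose[OF P, of y] x by metis
  then have "cinner x y = cinner x i"
    using cinner_eq_0_commute[of j x] by (simp add: cinner_simps)
  then show ?thesis using ij eq[of i] by (simp add: blinfun.add_right)
qed

lemma partial_isometry_norm_le:
  fixes P :: "'a::chilbert_space \<Rightarrow>\<^sub>L 'a"
  assumes P: "P \<in> partial_isometries"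
  shows "norm (P x) \<le> norm x"
proof -
  obtain i j where ij: "x = i + j" "norm (P i) = norm i" "P j = 0" "cinner j i = 0"
    using partial_isometry_decompose[OF P, of x] by metis
  have "(norm i)\<^sup>2 \<le> (norm x)\<^sup>2"
    using norm_add_orthogonal[OF ij(4)] unfolding ij(1) by (simp add: add.commute)
  then have "norm i \<le> norm x" by (rule power2_le_imp_le) simp
  moreover have "norm (P x) = norm i" unfolding ij(1) blinfun.add_right using ij(2,3) by simp
  ultimately show ?thesis by simp
qed

text \<open>Agreement on the initial space of \<open>P\<close> already forces both inclusions in the definition of the
  order.\<close>

lemma pi_le_iff:
  fixes P Q :: "'a::chilbert_space \<Rightarrow>\<^sub>L 'a"
  assumes P: "P \<in> partial_isometries" and Q: "Q \<in> partial_isometries"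
  shows "pi_le P Q \<longleftrightarrow> (\<forall>x. norm (P x) = norm x \<longrightarrow> Q x = P x)"
proof
  assume "pi_le P Q"
  then show "\<forall>x. norm (P x) = norm x \<longrightarrow> Q x = P x"
    by (simp add: pi_le_def initial_space_eq[OF P])
next
  assume *: "\<forall>x. norm (P x) = norm x \<longrightarrow> Q x = P x"
  have "P x \<in> range Q" for x
    using partial_isometry_decompose[OF P, of x] *
    by (metis add.right_neutral blinfun.add_right rangeI)
  then have "range P \<subseteq> range Q" by blast
  then show "pi_le P Q"
    using * by (simp add: pi_le_def initial_space_eq[OF P] initial_space_eq[OF Q] final_space_def subset_iff)
qed

text \<open>On the initial space of \<open>P\<close> the two operators agree. A vector \<open>j\<close> orthogonal to it is killed by
  \<open>P\<close>, and the part of \<open>j\<close> in the initial space of \<open>Q\<close> vanishes, because \<open>P\<close> is isometric there.\<close>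

lemma pi_le_antisym:
  fixes P Q :: "'a::chilbert_space \<Rightarrow>\<^sub>L 'a"
  assumes P: "P \<in> partial_isometries" and Q: "Q \<in> partial_isometries" and "pi_le P Q" "pi_le Q P"
  shows "P = Q"
proof (rule blinfun_eqI)
  fix x
  have PQ: "\<And>x. norm (P x) = norm x \<Longrightarrow> Q x = P x" and QP: "\<And>x. norm (Q x) = norm x \<Longrightarrow> P x = Q x"
    using assms(3,4) pi_le_iff[OF P Q] pi_le_iff[OF Q P] by blast+
  obtain i j where ij: "x = i + j" "norm (P i) = norm i" "P j = 0"
      "\<And>y. norm (P y) = norm y \<Longrightarrow> cinner j y = 0"
    using partial_isometry_decompose[OF P, of x] by metis
  obtain i' j' where ij': "j = i' + j'" "norm (Q i') = norm i'" "Q j' = 0" "cinner j' i' = 0"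
    using partial_isometry_decompose[OF Q, of j] by metis
  have "cinner j i' = 0" by (rule ij(4)) (simp add: QP ij')
  then have "cinner i' i' = 0" using ij' by (simp add: cinner_simps)
  then have "i' = 0" by (simp add: cinner_self)
  then show "P x = Q x" using ij ij' PQ[of i] by (simp add: blinfun.add_right)
qed

lemma zero_partial_isometry: "(0 :: 'a::chilbert_space \<Rightarrow>\<^sub>L 'a) \<in> partial_isometries"
  by (rule partial_isometryI[of _ "{0}"]) (auto intro!: csubspaceI)

lemma zero_pi_le: "Q \<in> partial_isometries \<Longrightarrow> pi_le 0 Q" for Q :: "'a::chilbert_space \<Rightarrow>\<^sub>L 'a"
  by (simp add: pi_le_iff zero_partial_isometry)

section \<open>Rank-one partial isometries\<close>

definition rank1 :: "'a::chilbert_space \<Rightarrow> 'a \<Rightarrow> 'a \<Rightarrow>\<^sub>L 'a" where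
  "rank1 e f = Blinfun (\<lambda>x. cinner x f *\<^sub>C e)"

lemma rank1_apply [simp]: "rank1 e f x = cinner x f *\<^sub>C e"
  unfolding rank1_def
  by (rule bounded_linear_Blinfun_apply[THEN fun_cong])
     (rule bounded_linear_compose[OF bounded_linear_scaleC bounded_linear_cinner_left])

text \<open>The pair \<open>(e, f)\<close> is determined by the operator up to a common phase. Everything below that
  chooses vectors for a rank-one operator has to cope with this phase.\<close>

lemma rank1_eq_iff:
  fixes e f g h :: "'a::chilbert_space"
  assumes "norm e = 1" "norm f = 1" "norm g = 1" "norm h = 1"
  shows "rank1 e f = rank1 g h \<longleftrightarrow> (\<exists>c. cmod c = 1 \<and> e = c *\<^sub>C g \<and> f = c *\<^sub>C h)"
proof
  assume eq: "rank1 e f = rank1 g h"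
  define c where "c = cinner f h"
  have "rank1 e f f = rank1 g h f" using eq by simp
  then have e: "e = c *\<^sub>C g" using assms by (simp add: cinner_self_unit c_def)
  then have c: "cmod c = 1" using assms norm_scaleC[of c g] by simp
  then have "f = c *\<^sub>C h" using eq_cinner_scaleC[of h f] assms by (simp add: c_def)
  then show "\<exists>c. cmod c = 1 \<and> e = c *\<^sub>C g \<and> f = c *\<^sub>C h" using e c by blast
next
  assume "\<exists>c. cmod c = 1 \<and> e = c *\<^sub>C g \<and> f = c *\<^sub>C h"
  then obtain c where "cmod c = 1" "e = c *\<^sub>C g" "f = c *\<^sub>C h" by blast
  then show "rank1 e f = rank1 g h"
    using complex_norm_square[of c]
    by (intro blinfun_eqI) (simp add: cinner_simps scaleC_scaleC mult.commute mult.left_commute)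
qed

lemma rank1_nonzero: "norm e = 1 \<Longrightarrow> norm f = 1 \<Longrightarrow> rank1 e f \<noteq> 0"
  by (metis cinner_self_unit norm_zero rank1_apply scaleC_one zero_blinfun.rep_eq zero_neq_one)

lemma csubspace_fixed: "csubspace {x. h x = x}"
  if "\<And>c x. h (c *\<^sub>C x) = c *\<^sub>C h x" for h :: "'a::complex_inner \<Rightarrow>\<^sub>L 'a"
  by (rule csubspaceI) (auto simp: that blinfun.add_right)

lemma closed_fixed: "closed {x. blinfun_apply h x = x}"
  by (intro closed_Collect_eq continuous_intros)

text \<open>The initial space is the span of \<open>f\<close> and \<open>h\<close>; written as the fixed space of an operator of rank
  two it is evidently closed.\<close>

lemma rank1_add_partial_isometry:
  fixes e f g h :: "'a::chilbert_space"
  assumes u: "norm e = 1" "norm f = 1" "norm g = 1" "norm h = 1" and o: "cinner e g = 0" "cinner f h = 0"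
  shows "rank1 e f + rank1 g h \<in> partial_isometries"
proof (rule partial_isometryI)
  let ?p = "rank1 f f + rank1 h h"
  show "(rank1 e f + rank1 g h) (c *\<^sub>C x) = c *\<^sub>C (rank1 e f + rank1 g h) x" for c x
    by (simp add: blinfun.add_left cinner_simps scaleC_add_right scaleC_scaleC)
  show "csubspace {x. ?p x = x}"
    by (rule csubspace_fixed) (simp add: blinfun.add_left cinner_simps scaleC_add_right scaleC_scaleC)
  show "closed {x. ?p x = x}" by (rule closed_fixed)
  show "norm ((rank1 e f + rank1 g h) x) = norm x" if "x \<in> {x. ?p x = x}" for x
  proof -
    define a b where "a = cinner x f" and "b = cinner x h"
    have "(norm (a *\<^sub>C e + b *\<^sub>C g))\<^sup>2 = (cmod a)\<^sup>2 + (cmod b)\<^sup>2"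
      by (subst norm_add_orthogonal) (auto simp: cinner_simps o norm_scaleC u)
    moreover have "(norm (a *\<^sub>C f + b *\<^sub>C h))\<^sup>2 = (cmod a)\<^sup>2 + (cmod b)\<^sup>2"
      by (subst norm_add_orthogonal) (auto simp: cinner_simps o norm_scaleC u)
    moreover have x: "a *\<^sub>C f + b *\<^sub>C h = x" using that by (simp add: a_def b_def blinfun.add_left)
    ultimately have "(norm (a *\<^sub>C e + b *\<^sub>C g))\<^sup>2 = (norm x)\<^sup>2" unfolding x by simp
    then show ?thesis
      by (simp add: a_def b_def blinfun.add_left power2_eq_iff_nonneg)
  qed
  show "(rank1 e f + rank1 g h) x = 0" if x: "x \<in> corthogonal_comp {x. ?p x = x}" for x
  proof -
    have "f \<in> {x. ?p x = x}" "h \<in> {x. ?p x = x}"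
      using o cinner_eq_0_commute[of f h] by (auto simp: blinfun.add_left cinner_self_unit u)
    then have "cinner x f = 0" "cinner x h = 0" using x by (auto simp: corthogonal_comp_def)
    then show ?thesis by (simp add: blinfun.add_left)
  qed
qed

lemma rank1_norm_eq:
  fixes e f :: "'a::chilbert_space"
  assumes u: "norm e = 1" "norm f = 1"
  shows "norm (rank1 e f x) = norm x \<longleftrightarrow> x = cinner x f *\<^sub>C f"
proof
  assume "norm (rank1 e f x) = norm x"
  then show "x = cinner x f *\<^sub>C f"
    using u by (intro eq_cinner_scaleC) (simp_all add: norm_scaleC)
next
  assume "x = cinner x f *\<^sub>C f"
  then have "norm x = cmod (cinner x f)" using u norm_scaleC by (metis mult.right_neutral)
  then show "norm (rank1 e f x) = norm x" using u by (simp add: norm_scaleC)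
qed

lemma rank1_partial_isometry:
  fixes e f :: "'a::chilbert_space"
  assumes u: "norm e = 1" "norm f = 1"
  shows "rank1 e f \<in> partial_isometries"
proof (rule partial_isometryI)
  show "rank1 e f (c *\<^sub>C x) = c *\<^sub>C rank1 e f x" for c x
    by (simp add: cinner_simps scaleC_scaleC)
  show "csubspace {x. rank1 f f x = x}"
    by (rule csubspace_fixed) (simp add: cinner_simps scaleC_scaleC)
  show "closed {x. rank1 f f x = x}" by (rule closed_fixed)
  show "norm (rank1 e f x) = norm x" if "x \<in> {x. rank1 f f x = x}" for x
    unfolding rank1_norm_eq[OF u] using that by simp
  show "rank1 e f x = 0" if x: "x \<in> corthogonal_comp {x. rank1 f f x = x}" for x
    using x by (simp add: corthogonal_comp_def) (metis cinner_self_unit u(2) scaleC_one scaleC_zero_left)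
qed

text \<open>The rank-one partial isometries below \<open>Q\<close> thus form the graph of \<open>Q\<close> over the unit sphere of
  its initial space.\<close>

lemma rank1_le_iff:
  fixes e f :: "'a::chilbert_space"
  assumes u: "norm e = 1" "norm f = 1" and Q: "Q \<in> partial_isometries"
  shows "pi_le (rank1 e f) Q \<longleftrightarrow> Q f = e"
proof
  assume "pi_le (rank1 e f) Q"
  then have "norm (rank1 e f f) = norm f \<longrightarrow> Q f = rank1 e f f"
    by (simp add: pi_le_iff[OF rank1_partial_isometry[OF u] Q])
  then show "Q f = e" using u by (simp add: cinner_self_unit)
next
  assume Qf: "Q f = e"
  have "Q x = rank1 e f x" if "norm (rank1 e f x) = norm x" for x
  proof -
    have x: "x = cinner x f *\<^sub>C f" using that unfolding rank1_norm_eq[OF u] .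
    have "Q x = cinner x f *\<^sub>C Q f" by (subst x) (rule partial_isometry_scaleC[OF Q])
    then show ?thesis by (simp add: Qf)
  qed
  then show "pi_le (rank1 e f) Q" by (simp add: pi_le_iff[OF rank1_partial_isometry[OF u] Q])
qed

definition minimal_pi :: "('a::chilbert_space \<Rightarrow>\<^sub>L 'a) \<Rightarrow> bool" where
  "minimal_pi P \<longleftrightarrow> P \<in> partial_isometries \<and> P \<noteq> 0 \<and>
     (\<forall>Q\<in>partial_isometries. pi_le Q P \<longrightarrow> Q = 0 \<or> Q = P)"

lemma nonzero_ge_rank1:
  fixes P :: "'a::chilbert_space \<Rightarrow>\<^sub>L 'a"
  assumes P: "P \<in> partial_isometries" "P \<noteq> 0"
  shows "\<exists>e f. norm e = 1 \<and> norm f = 1 \<and> pi_le (rank1 e f) P"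
proof -
  obtain x where "P x \<noteq> 0" using P(2) by (metis blinfun_eqI zero_blinfun.rep_eq)
  then obtain i where i: "norm (P i) = norm i" "P i \<noteq> 0"
    using partial_isometry_decompose[OF P(1), of x] by (metis add.right_neutral blinfun.add_right)
  define f where "f = sgn i"
  have "i \<noteq> 0" using i(2) by auto
  then have f: "norm f = 1" "norm (P f) = 1"
    using i by (auto simp: f_def norm_sgn sgn_div_norm blinfun.scaleR_right)
  then show ?thesis using rank1_le_iff[of "P f" f P] P by blast
qed

text \<open>Every nonzero \<open>P\<close> dominates the rank-one operator given by a unit vector of its initial space.
  Conversely, below \<open>rank1 e f\<close> the initial space is contained in the line of \<open>f\<close>.\<close>

lemma minimal_pi_iff:
  fixes P :: "'a::chilbert_space \<Rightarrow>\<^sub>L 'a"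
  shows "minimal_pi P \<longleftrightarrow> (\<exists>e f. norm e = 1 \<and> norm f = 1 \<and> P = rank1 e f)"
proof
  assume "minimal_pi P"
  then show "\<exists>e f. norm e = 1 \<and> norm f = 1 \<and> P = rank1 e f"
    unfolding minimal_pi_def using nonzero_ge_rank1[of P] rank1_partial_isometry rank1_nonzero by metis
next
  assume "\<exists>e f. norm e = 1 \<and> norm f = 1 \<and> P = rank1 e f"
  then obtain e f where u: "norm e = 1" "norm f = 1" and P: "P = rank1 e f" by blast
  have "Q = rank1 e f" if Q: "Q \<in> partial_isometries" "pi_le Q P" "Q \<noteq> 0" for Q
  proof -
    obtain g h where gh: "norm g = 1" "norm h = 1" "Q h = g"
      using nonzero_ge_rank1[OF Q(1,3)] rank1_le_iff[OF _ _ Q(1)] by blast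
    have r: "rank1 e f h = Q h"
      using Q(2) gh unfolding P pi_le_iff[OF Q(1) rank1_partial_isometry[OF u]] by simp
    then have h: "h = cinner h f *\<^sub>C f" using rank1_norm_eq[OF u, of h] gh by simp
    define c where "c = cinner h f"
    have "c \<noteq> 0" using h gh(2) by (auto simp: c_def)
    have "Q h = c *\<^sub>C Q f" using partial_isometry_scaleC[OF Q(1), of c f] h by (simp add: c_def)
    then have "c *\<^sub>C Q f = c *\<^sub>C e" using r unfolding rank1_apply c_def[symmetric] by auto
    then have "Q f = e" using \<open>c \<noteq> 0\<close> complex_vector.scale_left_imp_eq by blast
    then have "pi_le P Q" using rank1_le_iff[OF u Q(1)] P by simp
    then show ?thesis using pi_le_antisym[OF _ Q(1), of P] Q(2) P rank1_partial_isometry[OF u] by blast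
  qed
  then show "minimal_pi P"
    using u by (auto simp: minimal_pi_def P rank1_nonzero rank1_partial_isometry)
qed

text \<open>An upper bound restricts to an isometry on the two initial lines, so it preserves the inner
  product of their generators; conversely, equal inner products allow a rank-two upper bound.\<close>

lemma rank1_compatible_iff:
  fixes e f g h :: "'a::chilbert_space"
  assumes u: "norm e = 1" "norm f = 1" "norm g = 1" "norm h = 1"
  shows "(\<exists>R\<in>partial_isometries. pi_le (rank1 e f) R \<and> pi_le (rank1 g h) R)
    \<longleftrightarrow> cinner e g = cinner f h"
proof
  assume "\<exists>R\<in>partial_isometries. pi_le (rank1 e f) R \<and> pi_le (rank1 g h) R"
  then obtain R where R: "R \<in> partial_isometries" "R f = e" "R h = g"
    using rank1_le_iff u by blast
  then show "cinner e g = cinner f h"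
    using partial_isometry_cinner[OF R(1), of f h] u by simp
next
  assume eq: "cinner e g = cinner f h"
  define a where "a = cinner h f"
  \<comment> \<open>Subtracting the common component reduces the problem to two orthogonal residuals of equal norm.\<close>
  define p q where "p = h - a *\<^sub>C f" and "q = g - a *\<^sub>C e"
  have a': "cinner g e = a" using eq cinner_commute[of g e] cinner_commute[of h f] by (simp add: a_def)
  have "(norm p)\<^sup>2 = (norm q)\<^sup>2"
    using norm_residual[of f h] norm_residual[of e g] u a' by (simp add: p_def q_def a_def)
  then have n: "norm p = norm q" by (simp add: power2_eq_iff_nonneg)
  have orth: "cinner f p = 0" "cinner e q = 0"
    using a' cinner_self_unit u cinner_commute[of e g] cinner_commute[of f h]
    by (auto simp: p_def q_def cinner_simps a_def)
  show "\<exists>R\<in>partial_isometries. pi_le (rank1 e f) R \<and> pi_le (rank1 g h) R"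
  proof (cases "p = 0")
    case True
    then have "h = a *\<^sub>C f" "g = a *\<^sub>C e" using n by (auto simp: p_def q_def)
    then show ?thesis
      using rank1_partial_isometry[OF u(1,2)] u rank1_le_iff[OF _ _ rank1_partial_isometry[OF u(1,2)]]
      by (intro bexI[of _ "rank1 e f"]) (auto simp: cinner_simps cinner_self_unit)
  next
    case False
    then have q0: "q \<noteq> 0" using n by auto
    define s where "s = complex_of_real (inverse (norm p))"
    have s0: "s \<noteq> 0" using False by (simp add: s_def)
    let ?R = "rank1 e f + rank1 (s *\<^sub>C q) (s *\<^sub>C p)"
    have nu: "norm (s *\<^sub>C q) = 1" "norm (s *\<^sub>C p) = 1"
      using False q0 n by (auto simp: s_def norm_scaleC norm_inverse)
    have R: "?R \<in> partial_isometries"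
      using orth by (intro rank1_add_partial_isometry u nu) (auto simp: cinner_simps)
    have Rf: "?R f = e" using orth u by (simp add: blinfun.add_left cinner_simps cinner_self_unit)
    have "?R (s *\<^sub>C p) = s *\<^sub>C q"
      using orth cinner_self_unit[OF nu(2)] cinner_eq_0_commute[of p f]
      by (simp add: blinfun.add_left cinner_simps)
    then have "s *\<^sub>C ?R p = s *\<^sub>C q" using partial_isometry_scaleC[OF R, of s p] by simp
    then have "?R p = q" using s0 complex_vector.scale_left_imp_eq by blast
    then have "?R (p + a *\<^sub>C f) = q + a *\<^sub>C e"
      unfolding blinfun.add_right partial_isometry_scaleC[OF R] Rf by simp
    then have "?R h = g" by (simp add: p_def q_def)
    then show ?thesis using R Rf u rank1_le_iff[OF _ _ R] by blast
  qed
qed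

section \<open>Adjoints of partial isometries\<close>

lemma hadjoint_eqI:
  fixes R S :: "'a::chilbert_space \<Rightarrow>\<^sub>L 'a"
  assumes "\<And>x y. cinner (R x) y = cinner x (S y)"
  shows "hadjoint R = S"
  unfolding hadjoint_def
proof (rule the_equality)
  fix T :: "'a \<Rightarrow>\<^sub>L 'a" assume "\<forall>x y. cinner (R x) y = cinner x (T y)"
  then show "T = S" using assms by (metis blinfun_eqI cinner_ext_right)
qed (use assms in blast)

lemma hadjoint_rank1: "hadjoint (rank1 e f) = rank1 f e"
  by (rule hadjoint_eqI) (simp add: cinner_simps cinner_commute[of _ e])

lemma rank1_orthogonal_iff:
  fixes e f g h :: "'a::chilbert_space"
  assumes u: "norm e = 1" "norm f = 1" "norm g = 1" "norm h = 1"
  shows "pi_orthogonal (rank1 e f) (rank1 g h) \<longleftrightarrow> cinner e g = 0 \<and> cinner f h = 0"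
proof -
  have *: "rank1 a b o\<^sub>L rank1 c d = 0 \<longleftrightarrow> cinner b c = 0"
    if v: "norm a = 1" "norm d = 1" for a b c d :: 'a
  proof
    assume "rank1 a b o\<^sub>L rank1 c d = 0"
    then have "(rank1 a b o\<^sub>L rank1 c d) d = 0" by simp
    then have "cinner c b *\<^sub>C a = 0" using v by (simp add: cinner_self_unit)
    then have "cmod (cinner c b) * norm a = 0" by (metis norm_scaleC norm_zero)
    then show "cinner b c = 0" using v cinner_eq_0_commute[of b c] by simp
  next
    assume "cinner b c = 0"
    then show "rank1 a b o\<^sub>L rank1 c d = 0"
      using cinner_eq_0_commute[of b c] by (intro blinfun_eqI) (simp add: cinner_simps)
  qed
  show ?thesis by (simp add: pi_orthogonal_def hadjoint_rank1 * u)
qed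

text \<open>The range is the isometric image of the complete initial space.\<close>

lemma partial_isometry_closed_range:
  fixes R :: "'a::chilbert_space \<Rightarrow>\<^sub>L 'a"
  assumes R: "R \<in> partial_isometries"
  shows "closed (range R)" "csubspace (range R)"
proof -
  let ?I = "{x. norm (R x) = norm x}"
  have I: "csubspace ?I" "closed ?I"
    using initial_space_eq(2)[OF R] by (auto simp: is_initial_space_def)
  have eq: "range R = R ` ?I"
  proof -
    have "R x \<in> R ` ?I" for x
    proof -
      obtain i j where ij: "x = i + j" "norm (R i) = norm i" "R j = 0"
        using partial_isometry_decompose[OF R, of x] by metis
      then have "R x = R i" by (simp add: blinfun.add_right)
      then show ?thesis using ij(2) by blast
    qed
    then show ?thesis by blast
  qed
  show "csubspace (range R)"
  proof (rule csubspaceI)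
    show "0 \<in> range R" using blinfun.zero_right[of R] by (metis rangeI)
    show "x + y \<in> range R" if "x \<in> range R" "y \<in> range R" for x y
      using that by (auto simp flip: blinfun.add_right)
    show "c *\<^sub>C x \<in> range R" if "x \<in> range R" for c x
      using that by (auto simp flip: partial_isometry_scaleC[OF R])
  qed
  have "complete (R ` ?I)"
  proof (rule complete_isometric_image[where e = 1])
    show "subspace ?I"
      unfolding subspace_def using csubspaceD(1,2,5)[OF I(1)] by blast
    show "bounded_linear R" by (rule blinfun.bounded_linear_right)
    show "complete ?I" using I(2) by (simp add: complete_eq_closed)
  qed auto
  then show "closed (range R)" unfolding eq by (rule complete_imp_closed)
qed

text \<open>The adjoint sends \<open>y\<close> to the vector of the initial space that \<open>R\<close> maps to the projection of \<open>y\<close>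
  onto the range of \<open>R\<close>. Such a vector is determined by its inner products, which gives linearity
  without computing with projections.\<close>

lemma adjoint_exists:
  fixes R :: "'a::chilbert_space \<Rightarrow>\<^sub>L 'a"
  assumes R: "R \<in> partial_isometries"
  obtains S where "S \<in> partial_isometries" "\<And>x y. cinner (R x) y = cinner x (S y)"
proof -
  note F = partial_isometry_closed_range[OF R]
  have ex: "\<exists>s. (\<forall>x. cinner (R x) y = cinner x s) \<and> norm s \<le> norm y \<and>
      (y \<in> range R \<longrightarrow> norm s = norm y)" for y
  proof -
    obtain a b where ab: "y = a + b" "a \<in> range R" "b \<in> corthogonal_comp (range R)"
      using projection_theorem[OF F(2,1)] by blast
    have b: "cinner (R x) b = 0" for x
      using ab(3) cinner_eq_0_commute by (auto simp: corthogonal_comp_def)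
    obtain z where "a = R z" using ab(2) by blast
    then obtain i where i: "a = R i" "norm (R i) = norm i"
      using partial_isometry_decompose[OF R, of z] by (metis add.right_neutral blinfun.add_right)
    have "cinner (R x) y = cinner x i" for x
    proof -
      have "cinner (R x) (R i) = cinner x i"
        using partial_isometry_cinner[OF R i(2), of x] cinner_commute[of "R x" "R i"]
          cinner_commute[of x i] by simp
      then show ?thesis using b[of x] by (simp add: ab(1) i(1) cinner_add_right)
    qed
    moreover have "cinner a b = 0" using b[of i] i by simp
    then have "(norm y)\<^sup>2 = (norm i)\<^sup>2 + (norm b)\<^sup>2" using norm_add_orthogonal[of a b] ab i by simp
    then have "(norm i)\<^sup>2 \<le> (norm y)\<^sup>2" by simp
    then have "norm i \<le> norm y" by (rule power2_le_imp_le) simp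
    moreover have "norm i = norm y" if "y \<in> range R"
    proof -
      have "cinner y b = 0" using that b by auto
      then have "cinner b b = 0" using \<open>cinner a b = 0\<close> ab(1) by (simp add: cinner_simps)
      then have "b = 0" by (simp add: cinner_self)
      then show ?thesis using ab i by simp
    qed
    ultimately show ?thesis by blast
  qed
  obtain s where "\<forall>y. (\<forall>x. cinner (R x) y = cinner x (s y)) \<and> norm (s y) \<le> norm y \<and>
      (y \<in> range R \<longrightarrow> norm (s y) = norm y)"
    using choice[OF allI[OF ex]] by (rule exE)
  then have s: "\<And>x y. cinner (R x) y = cinner x (s y)" and sn: "\<And>y. norm (s y) \<le> norm y"
    and siso: "\<And>y. y \<in> range R \<Longrightarrow> norm (s y) = norm y"
    by blast+
  have s_add: "s (x + y) = s x + s y" for x y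
    by (rule cinner_ext_right) (simp add: cinner_simps s[symmetric])
  have s_scale: "s (c *\<^sub>C x) = c *\<^sub>C s x" for c x
    by (rule cinner_ext_right) (simp add: cinner_simps s[symmetric])
  have bl: "bounded_linear s"
    by (rule bounded_linear_intro[where K = 1]) (auto simp: s_add s_scale scaleR_scaleC sn)
  define S where "S = Blinfun s"
  have S: "blinfun_apply S = s" unfolding S_def by (rule bounded_linear_Blinfun_apply[OF bl])
  have "S \<in> partial_isometries"
  proof (rule partial_isometryI[OF _ F(2,1)])
    show "S y = 0" if "y \<in> corthogonal_comp (range R)" for y
    proof -
      have "cinner y (R (s y)) = 0" using that by (simp add: corthogonal_comp_def)
      then have "cinner (s y) (s y) = 0" using s[of "s y" y] cinner_eq_0_commute[of y "R (s y)"] by simp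
      then show ?thesis by (simp add: cinner_self S)
    qed
  qed (auto simp: S s_scale siso)
  then show ?thesis by (rule that) (simp add: s S)
qed

lemma hadjoint_partial_isometry:
  fixes R :: "'a::chilbert_space \<Rightarrow>\<^sub>L 'a"
  assumes R: "R \<in> partial_isometries"
  shows "hadjoint R \<in> partial_isometries" "cinner (R x) y = cinner x (hadjoint R y)"
proof -
  obtain S where S: "S \<in> partial_isometries" "\<And>x y. cinner (R x) y = cinner x (S y)"
    using adjoint_exists[OF R] by blast
  have "hadjoint R = S" by (rule hadjoint_eqI) (rule S(2))
  then show "hadjoint R \<in> partial_isometries" "cinner (R x) y = cinner x (hadjoint R y)"
    using S by auto
qed

text \<open>Both sides say that the Cauchy-Schwarz bound for \<open>\<langle>R f, e\<rangle> = \<langle>f, R\<^sup>* e\<rangle>\<close> is attained with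
  value \<open>1\<close>.\<close>

lemma hadjoint_unit_iff:
  fixes R :: "'a::chilbert_space \<Rightarrow>\<^sub>L 'a"
  assumes R: "R \<in> partial_isometries" and u: "norm e = 1" "norm f = 1"
  shows "hadjoint R e = f \<longleftrightarrow> R f = e"
proof
  assume "R f = e"
  then have "cinner f (hadjoint R e) = 1"
    using hadjoint_partial_isometry(2)[OF R, of f e] u by (simp add: cinner_self_unit)
  then have "cinner (hadjoint R e) f = 1" using cinner_commute[of "hadjoint R e" f] by simp
  then show "hadjoint R e = f"
    using partial_isometry_norm_le[OF hadjoint_partial_isometry(1)[OF R], of e] u
    by (intro unit_eq_of_cinner_1) auto
next
  assume "hadjoint R e = f"
  then have "cinner (R f) e = 1"
    using hadjoint_partial_isometry(2)[OF R, of f e] u by (simp add: cinner_self_unit)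
  then show "R f = e"
    using partial_isometry_norm_le[OF R, of f] u by (intro unit_eq_of_cinner_1) auto
qed

section \<open>Rigidity of maps that preserve equality of inner products\<close>

text \<open>Additivity fixes the values at the multiples of \<open>1/n\<close>, and non-negativity makes \<open>g\<close> monotone,
  so \<open>g x\<close> and \<open>x\<close> differ by at most \<open>1/n\<close>.\<close>

lemma additive_nonneg_unit_interval:
  fixes g :: "real \<Rightarrow> real"
  assumes nonneg: "\<And>x. 0 \<le> x \<Longrightarrow> x \<le> 1 \<Longrightarrow> 0 \<le> g x" and one: "g 1 = 1"
    and add: "\<And>x y. 0 \<le> x \<Longrightarrow> 0 \<le> y \<Longrightarrow> x + y \<le> 1 \<Longrightarrow> g (x + y) = g x + g y"
    and x: "0 \<le> x" "x \<le> 1"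
  shows "g x = x"
proof -
  have mult: "g (real m * t) = real m * g t" if "0 \<le> t" "real m * t \<le> 1" for m t
    using that
  proof (induction m)
    case 0
    then show ?case using add[of 0 0] by simp
  next
    case (Suc m)
    have le: "real m * t + t \<le> 1" using Suc.prems by (simp add: algebra_simps)
    have "g (real m * t + t) = g (real m * t) + g t" by (rule add) (use Suc.prems le in auto)
    moreover have "g (real m * t) = real m * g t"
      using Suc.prems le by (intro Suc.IH) linarith+
    ultimately show ?case by (simp add: algebra_simps)
  qed
  have bound: "\<bar>g x - x\<bar> \<le> inverse (real (Suc n))" for n
  proof -
    define N where "N = real (Suc n)"
    define m where "m = nat \<lfloor>N * x\<rfloor>"
    define r where "r = x - real m * inverse N"
    have N: "N > 0" by (simp add: N_def)
    have m: "real m \<le> N * x" "N * x < real m + 1"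
      using x N by (simp_all add: m_def)
    have r: "0 \<le> r" "r \<le> inverse N"
    proof -
      have eq: "r = (N * x - real m) * inverse N" using N by (simp add: r_def field_simps)
      show "0 \<le> r" using m N by (simp add: eq)
      show "r \<le> inverse N" using mult_right_mono[of "N * x - real m" 1 "inverse N"] m N by (simp add: eq)
    qed
    have iN: "0 \<le> inverse N" "inverse N \<le> 1" by (simp_all add: N_def field_simps)
    have gN: "g (inverse N) = inverse N"
      using mult[of "inverse N" "Suc n"] N one by (simp add: N_def field_simps)
    have mx: "real m * inverse N \<le> x" using r by (simp add: r_def)
    have "g x = g (real m * inverse N + r)" by (simp add: r_def)
    also have "\<dots> = g (real m * inverse N) + g r"
      by (rule add) (use r x iN in \<open>auto simp: r_def\<close>)
    also have "g (real m * inverse N) = real m * inverse N"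
      using mult[of "inverse N" m] gN iN mx x by simp
    finally have gx: "g x - x = g r - r" by (simp add: r_def)
    have "g (inverse N) = g r + g (inverse N - r)"
      using add[of r "inverse N - r"] r iN by simp
    then have "g r \<le> inverse N" using nonneg[of "inverse N - r"] r iN gN by simp
    moreover have "0 \<le> g r" using nonneg[of r] r iN by simp
    ultimately show ?thesis using gx r unfolding N_def by linarith
  qed
  have "(\<lambda>n. inverse (real (Suc n))) \<longlonglongrightarrow> 0" by (rule LIMSEQ_inverse_real_of_nat)
  then have "\<bar>g x - x\<bar> \<le> 0"
    by (rule LIMSEQ_le_const) (use bound in auto)
  then show ?thesis by simp
qed

text \<open>The hypothesis says that applying \<open>k\<close> to the coordinates of unit vectors of \<open>\<complex>\<^sup>3\<close> applies \<open>k\<close>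
  to their inner product. Three coordinates leave room for two unit vectors that overlap in one
  coordinate only, and this makes \<open>k\<close> multiplicative. A unit vector paired with itself shows
  that \<open>x + y + z = 1\<close> implies \<open>k x + k y + k z = 1\<close> for non-negative reals, so \<open>k\<close> is additive, hence
  the identity, on \<open>[0, 1]\<close>. Pairing with \<open>(1, 1, 0) / \<surd>2\<close> yields additivity on complex arguments,
  after which only the value \<open>k \<i> = \<plusminus>\<i>\<close> is free.\<close>

lemma inner_product_function:
  fixes k :: "complex \<Rightarrow> complex"
  assumes k1: "k 1 = 1" and k0: "k 0 = 0"
    and k: "\<And>a1 a2 a3 b1 b2 b3.
      (cmod a1)\<^sup>2 + (cmod a2)\<^sup>2 + (cmod a3)\<^sup>2 = 1 \<Longrightarrow> (cmod b1)\<^sup>2 + (cmod b2)\<^sup>2 + (cmod b3)\<^sup>2 = 1 \<Longrightarrow>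
      k (a1 * cnj b1 + a2 * cnj b2 + a3 * cnj b3) = k a1 * cnj (k b1) + k a2 * cnj (k b2) + k a3 * cnj (k b3)"
  shows "(\<forall>z. cmod z \<le> 1 \<longrightarrow> k z = z) \<or> (\<forall>z. cmod z \<le> 1 \<longrightarrow> k z = cnj z)"
proof -
  \<comment> \<open>\<open>s z\<close> completes the coordinate \<open>z\<close> to a unit vector.\<close>
  define s where "s = (\<lambda>z. complex_of_real (sqrt (1 - (cmod z)\<^sup>2)))"
  have s: "(cmod z)\<^sup>2 + (cmod (s z))\<^sup>2 = 1" if "cmod z \<le> 1" for z
    using that by (simp add: s_def abs_square_le_1)
  have k_cnj: "k (cnj z) = cnj (k z)" if "cmod z \<le> 1" for z
    using k[of 1 0 0 z "s z" 0] s[OF that] by (simp add: k0 k1)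
  have k_mult: "k (z * w) = k z * k w" if "cmod z \<le> 1" "cmod w \<le> 1" for z w
    using k[of z "s z" 0 "cnj w" 0 "s w"] s[OF that(1)] s[OF that(2)] k_cnj[OF that(2)]
    by (simp add: k0)
  have k_real: "k (of_real x) = of_real (Re (k (of_real x)))" if "0 \<le> x" "x \<le> 1" for x
    using k_cnj[of "of_real x"] that by (simp add: complex_eq_iff)
  have k_sqrt: "k (of_real x) = k (of_real (sqrt x)) * k (of_real (sqrt x))" if "0 \<le> x" "x \<le> 1" for x
    using k_mult[of "of_real (sqrt x)" "of_real (sqrt x)"] that by (simp flip: of_real_mult)
  define g where "g x = Re (k (of_real x))" for x
  have kg: "k (of_real x) = of_real (g x)" if "0 \<le> x" "x \<le> 1" for x
    using k_real[OF that] by (simp add: g_def)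
  have g_sqrt: "g x = g (sqrt x) * g (sqrt x)" if "0 \<le> x" "x \<le> 1" for x
    using k_sqrt[OF that] kg[of "sqrt x"] kg[OF that] that by (simp flip: of_real_mult)
  have g_sum: "g x + g y + g z = 1" if "0 \<le> x" "0 \<le> y" "0 \<le> z" "x + y + z = 1" for x y z
  proof -
    have "k 1 = of_real (g x) + of_real (g y) + of_real (g z)"
      using k[of "of_real (sqrt x)" "of_real (sqrt y)" "of_real (sqrt z)"
          "of_real (sqrt x)" "of_real (sqrt y)" "of_real (sqrt z)"] that
        kg[of "sqrt x"] kg[of "sqrt y"] kg[of "sqrt z"]
      by (simp add: g_sqrt[of x] g_sqrt[of y] g_sqrt[of z] flip: of_real_mult of_real_add)
    then show ?thesis by (simp add: k1 flip: of_real_add)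
  qed
  have g: "g x = x" if "0 \<le> x" "x \<le> 1" for x
  proof (rule additive_nonneg_unit_interval[OF _ _ _ that])
    show "0 \<le> g x" if "0 \<le> x" "x \<le> 1" for x using g_sqrt[OF that] by simp
    show "g 1 = 1" by (simp add: g_def k1)
    show "g (x + y) = g x + g y" if "0 \<le> x" "0 \<le> y" "x + y \<le> 1" for x y
      using g_sum[of x y "1 - x - y"] g_sum[of "x + y" 0 "1 - x - y"] that by (simp add: g_def k0)
  qed
  have k_id: "k (of_real x) = of_real x" if "0 \<le> x" "x \<le> 1" for x using kg[OF that] g[OF that] by simp
  have k_add: "k (z + w) = k z + k w" if zw: "(cmod z)\<^sup>2 + (cmod w)\<^sup>2 \<le> 1" "cmod (z + w) \<le> 1" for z w
  proof -
    \<comment> \<open>Pair \<open>(z, w, \<dots>)\<close> with \<open>(c, c, 0)\<close>; the factor \<open>c\<close> can be pulled out of \<open>k\<close> again.\<close>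
    define c where "c = sqrt (1/2)"
    have c: "c * c = 1/2" "0 \<le> c" "c \<le> 1" by (auto simp: c_def)
    then have c2: "c\<^sup>2 = 1/2" by (simp add: power2_eq_square)
    have "k (of_real c * (z + w)) = of_real c * k (z + w)"
      using k_mult[of "of_real c" "z + w"] k_id[of c] c zw by simp
    moreover have "k (of_real c * (z + w)) = of_real c * (k z + k w)"
      using k[of z w "of_real (sqrt (1 - (cmod z)\<^sup>2 - (cmod w)\<^sup>2))" "of_real c" "of_real c" 0] zw c c2 k_id[of c]
      by (simp add: k0 algebra_simps)
    ultimately show ?thesis using c by auto
  qed
  have "k (1/2 + - (1/2)) = k (1/2) + k (- (1/2))" by (rule k_add) (auto simp: power2_eq_square)
  moreover have "k (- 1 * (1/2)) = k (- 1) * k (1/2)" by (rule k_mult) auto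
  moreover have "k (1/2) = 1/2" using k_id[of "1/2"] by simp
  ultimately have "- k (- 1) = 1" by (simp add: k0 field_simps add_eq_0_iff2)
  then have km1: "k (- 1) = - 1" by (metis minus_minus)
  have k_id': "k (of_real x) = of_real x" if "\<bar>x\<bar> \<le> 1" for x
    using k_id[of x] k_id[of "- x"] k_mult[of "- 1" "of_real (- x)"] that km1
    by (cases "x \<ge> 0") auto
  have "k \<i> * k \<i> = - 1" using k_mult[of \<i> \<i>] km1 by simp
  then have "(k \<i> - \<i>) * (k \<i> + \<i>) = 0" by (simp add: algebra_simps)
  then have ki: "k \<i> = \<i> \<or> k \<i> = - \<i>" by (auto simp: eq_neg_iff_add_eq_0)
  have "k z = of_real (Re z) + k \<i> * of_real (Im z)" if z: "cmod z \<le> 1" for z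
  proof -
    have re: "\<bar>Re z\<bar> \<le> 1" and im: "\<bar>Im z\<bar> \<le> 1"
      using z abs_Re_le_cmod[of z] abs_Im_le_cmod[of z] by linarith+
    have "(cmod z)\<^sup>2 \<le> 1" using z by (simp add: abs_square_le_1)
    then have "(Re z)\<^sup>2 + (Im z)\<^sup>2 \<le> 1" by (simp add: cmod_power2)
    then have "k (of_real (Re z) + \<i> * of_real (Im z)) = k (of_real (Re z)) + k (\<i> * of_real (Im z))"
      using z by (intro k_add) (auto simp: norm_mult complex_eq[symmetric])
    then show ?thesis
      unfolding complex_eq[symmetric] using k_mult[of \<i> "of_real (Im z)"] im k_id'[OF re] k_id'[OF im]
      by simp
  qed
  then have kz: "\<And>z. cmod z \<le> 1 \<Longrightarrow> k z = of_real (Re z) + k \<i> * of_real (Im z)" .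
  from ki show ?thesis
  proof
    assume "k \<i> = \<i>"
    then have "k z = z" if "cmod z \<le> 1" for z using kz[OF that] by (simp add: complex_eq_iff)
    then show ?thesis by blast
  next
    assume "k \<i> = - \<i>"
    then have "k z = cnj z" if "cmod z \<le> 1" for z using kz[OF that] by (simp add: complex_eq_iff)
    then show ?thesis by blast
  qed
qed

lemma norm_eq_1_of_square: "(norm x)\<^sup>2 = 1 \<Longrightarrow> norm x = 1" for x :: "'a::complex_inner"
  using power2_eq_iff_nonneg[of "norm x" 1] by simp

definition orthonormal3 :: "'a::complex_inner \<Rightarrow> 'a \<Rightarrow> 'a \<Rightarrow> bool" where
  "orthonormal3 x y z \<longleftrightarrow> norm x = 1 \<and> norm y = 1 \<and> norm z = 1 \<and>
     cinner x y = 0 \<and> cinner x z = 0 \<and> cinner y z = 0"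

lemma orthonormal3D:
  assumes "orthonormal3 x y z"
  shows "cinner x x = 1" "cinner y y = 1" "cinner z z = 1" "cinner x y = 0" "cinner x z = 0" "cinner y z = 0"
    "cinner y x = 0" "cinner z x = 0" "cinner z y = 0"
  using assms cinner_eq_0_commute by (auto simp: orthonormal3_def cinner_self_unit)

text \<open>By hypothesis \<open>\<langle>U e, U f\<rangle>\<close> is a function \<open>k\<close> of \<open>\<langle>e, f\<rangle>\<close>. Since \<open>U\<close> preserves orthogonality and its
  values exhaust the lines, a vector orthogonal to \<open>U x1\<close>, \<open>U x2\<close>, \<open>U x3\<close> is orthogonal to \<open>U v\<close> for
  every \<open>v\<close> in the span of \<open>x1\<close>, \<open>x2\<close>, \<open>x3\<close>. So \<open>U v\<close> is the combination of \<open>U x1\<close>, \<open>U x2\<close>, \<open>U x3\<close>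
  whose coefficients are the values of \<open>k\<close> at the coordinates of \<open>v\<close>, and the functional equation
  for \<open>k\<close> is the expansion of \<open>\<langle>U v, U w\<rangle>\<close>.\<close>

lemma gram_map_rigid:
  fixes U :: "'a::complex_inner \<Rightarrow> 'a" and x1 x2 x3 :: 'a
  assumes b: "orthonormal3 x1 x2 x3"
    and unit: "\<And>e. norm e = 1 \<Longrightarrow> norm (U e) = 1"
    and gram: "\<And>e f e' f'. norm e = 1 \<Longrightarrow> norm f = 1 \<Longrightarrow> norm e' = 1 \<Longrightarrow> norm f' = 1 \<Longrightarrow>
      cinner e e' = cinner f f' \<Longrightarrow> cinner (U e) (U e') = cinner (U f) (U f')"
    and orth: "\<And>e f. norm e = 1 \<Longrightarrow> norm f = 1 \<Longrightarrow> cinner (U e) (U f) = 0 \<longleftrightarrow> cinner e f = 0"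
    and surj: "\<And>g. norm g = 1 \<Longrightarrow> \<exists>e c. norm e = 1 \<and> g = c *\<^sub>C U e"
  shows "(\<forall>e f. norm e = 1 \<longrightarrow> norm f = 1 \<longrightarrow> cinner (U e) (U f) = cinner e f) \<or>
         (\<forall>e f. norm e = 1 \<longrightarrow> norm f = 1 \<longrightarrow> cinner (U e) (U f) = cnj (cinner e f))"
proof -
  note x = orthonormal3D[OF b]
  have nx: "norm x1 = 1" "norm x2 = 1" "norm x3 = 1" using b by (auto simp: orthonormal3_def)
  define v where "v a1 a2 a3 = a1 *\<^sub>C x1 + a2 *\<^sub>C x2 + a3 *\<^sub>C x3" for a1 a2 a3
  have v: "cinner (v a1 a2 a3) (v b1 b2 b3) = a1 * cnj b1 + a2 * cnj b2 + a3 * cnj b3" for a1 a2 a3 b1 b2 b3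
    by (simp add: v_def cinner_simps x)
  have nv: "norm (v a1 a2 a3) = 1" if "(cmod a1)\<^sup>2 + (cmod a2)\<^sup>2 + (cmod a3)\<^sup>2 = 1" for a1 a2 a3
  proof -
    have "cinner (v a1 a2 a3) (v a1 a2 a3) = of_real ((cmod a1)\<^sup>2 + (cmod a2)\<^sup>2 + (cmod a3)\<^sup>2)"
      unfolding v of_real_add complex_norm_square ..
    then have "(norm (v a1 a2 a3))\<^sup>2 = 1" using that by (simp add: norm_sq_Re_cinner)
    then show ?thesis by (rule norm_eq_1_of_square)
  qed
  \<comment> \<open>A sample pair of unit vectors with inner product \<open>z\<close>; by \<open>gram\<close> the choice does not matter.\<close>
  define k where "k z = cinner (U (v z (of_real (sqrt (1 - (cmod z)\<^sup>2))) 0)) (U x1)" for z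
  have k: "cinner (U e) (U f) = k (cinner e f)" if u: "norm e = 1" "norm f = 1" for e f
    unfolding k_def
  proof (rule gram)
    have "cmod (cinner e f) \<le> 1" using cauchy_schwarz[of e f] u by simp
    then show "norm (v (cinner e f) (of_real (sqrt (1 - (cmod (cinner e f))\<^sup>2))) 0) = 1"
      by (intro nv) (simp add: abs_square_le_1)
    show "cinner e f = cinner (v (cinner e f) (of_real (sqrt (1 - (cmod (cinner e f))\<^sup>2))) 0) x1"
      by (simp add: v_def cinner_simps x)
  qed (use u nx in auto)
  have k1: "k 1 = 1" using k[of x1 x1] nx x unit[of x1] by (simp add: cinner_self_unit)
  have k0: "k 0 = 0" using k[of x1 x2] nx x orth[of x1 x2] by simp
  have Ux: "cinner (U x1) (U x1) = 1" "cinner (U x2) (U x2) = 1" "cinner (U x3) (U x3) = 1"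
    "cinner (U x1) (U x2) = 0" "cinner (U x1) (U x3) = 0" "cinner (U x2) (U x3) = 0"
    "cinner (U x2) (U x1) = 0" "cinner (U x3) (U x1) = 0" "cinner (U x3) (U x2) = 0"
    by (simp_all add: k nx x k0 k1)
  have Uv: "U (v a1 a2 a3) = k a1 *\<^sub>C U x1 + k a2 *\<^sub>C U x2 + k a3 *\<^sub>C U x3"
    if a: "(cmod a1)\<^sup>2 + (cmod a2)\<^sup>2 + (cmod a3)\<^sup>2 = 1" for a1 a2 a3
  proof -
    define w where "w = v a1 a2 a3"
    \<comment> \<open>The part of \<open>U w\<close> orthogonal to the three images must vanish.\<close>
    define r where "r = U w - (k a1 *\<^sub>C U x1 + k a2 *\<^sub>C U x2 + k a3 *\<^sub>C U x3)"
    have w: "norm w = 1" using nv[OF a] by (simp add: w_def)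
    have "cinner w x1 = a1" "cinner w x2 = a2" "cinner w x3 = a3"
      by (simp_all add: w_def v_def cinner_simps x)
    then have r: "cinner r (U x1) = 0" "cinner r (U x2) = 0" "cinner r (U x3) = 0"
      by (simp_all add: r_def cinner_simps Ux k w nx)
    have "r = 0"
    proof (rule ccontr)
      assume r0: "r \<noteq> 0"
      obtain y c where y: "norm y = 1" "sgn r = c *\<^sub>C U y" using surj[OF norm_sgn_unit[OF r0]] by blast
      have "r = of_real (norm r) *\<^sub>C sgn r"
        using r0 by (simp add: sgn_div_norm flip: scaleR_scaleC)
      then have ry: "r = (of_real (norm r) * c) *\<^sub>C U y" using y by (simp add: scaleC_scaleC)
      have ne: "of_real (norm r) * c \<noteq> 0" using r0 ry by (metis scaleC_zero_left)
      have "cinner (U y) (U z) = 0 \<longleftrightarrow> cinner r (U z) = 0" for z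
        using ne by (subst ry) (simp only: cinner_scaleC_left mult_eq_0_iff, simp)
      then have perp: "cinner y z = 0 \<longleftrightarrow> cinner r (U z) = 0" if "norm z = 1" for z
        using orth[OF y(1) that] by simp
      have "cinner y x1 = 0" "cinner y x2 = 0" "cinner y x3 = 0" using perp r nx by auto
      then have "cinner y w = 0" by (simp add: w_def v_def cinner_simps)
      then have "cinner r (U w) = 0" using perp w by simp
      then have "cinner r r = 0"
        using r by (subst (2) r_def) (simp add: cinner_simps)
      then show False using r0 by (simp add: cinner_self)
    qed
    then show ?thesis by (simp add: r_def w_def)
  qed
  have "(\<forall>z. cmod z \<le> 1 \<longrightarrow> k z = z) \<or> (\<forall>z. cmod z \<le> 1 \<longrightarrow> k z = cnj z)"
  proof (rule inner_product_function[OF k1 k0])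
    fix a1 a2 a3 b1 b2 b3
    assume a: "(cmod a1)\<^sup>2 + (cmod a2)\<^sup>2 + (cmod a3)\<^sup>2 = 1" and b: "(cmod b1)\<^sup>2 + (cmod b2)\<^sup>2 + (cmod b3)\<^sup>2 = 1"
    have "k (a1 * cnj b1 + a2 * cnj b2 + a3 * cnj b3) = cinner (U (v a1 a2 a3)) (U (v b1 b2 b3))"
      by (simp add: k nv a b v)
    also have "\<dots> = k a1 * cnj (k b1) + k a2 * cnj (k b2) + k a3 * cnj (k b3)"
      by (simp add: Uv a b cinner_simps Ux)
    finally show "k (a1 * cnj b1 + a2 * cnj b2 + a3 * cnj b3)
      = k a1 * cnj (k b1) + k a2 * cnj (k b2) + k a3 * cnj (k b3)" .
  qed
  moreover have "cmod (cinner e f) \<le> 1" if "norm e = 1" "norm f = 1" for e f :: 'a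
    using cauchy_schwarz[of e f] that by simp
  ultimately show ?thesis using k by auto
qed

text \<open>The defect of the identity at \<open>(e, f, h)\<close> does not change when \<open>e\<close>, \<open>f\<close>, \<open>h\<close> are replaced by unit
  vectors \<open>x\<close>, \<open>y\<close>, \<open>z\<close> with \<open>\<langle>e, x\<rangle> = \<langle>f, y\<rangle> = \<langle>h, z\<rangle> \<noteq> 0\<close>, because the relation \<open>gram\<close> applies to each of the
  three pairs. It vanishes at \<open>(h, h, h)\<close>. Four such steps lead from any unit vector to \<open>h\<close> with
  inner products that do not depend on the vector: with \<open>w e\<close> orthogonal to \<open>e\<close> and \<open>h\<close>, pass
  through \<open>3/5 e + 4/5 w e\<close>, \<open>w e\<close>, and \<open>3/5 h + 4/5 w e\<close>.\<close>

lemma cocycle_identity: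
  fixes U :: "'a::complex_inner \<Rightarrow> 'a" and c :: "'a \<Rightarrow> 'a \<Rightarrow> complex"
  assumes dim: "\<And>x y :: 'a. \<exists>u. norm u = 1 \<and> cinner u x = 0 \<and> cinner u y = 0"
    and orth: "\<And>e f. norm e = 1 \<Longrightarrow> norm f = 1 \<Longrightarrow> cinner (U e) (U f) = 0 \<longleftrightarrow> cinner e f = 0"
    and diag: "\<And>e. norm e = 1 \<Longrightarrow> c e e = 1"
    and gram: "\<And>e f e' f'. norm e = 1 \<Longrightarrow> norm f = 1 \<Longrightarrow> norm e' = 1 \<Longrightarrow> norm f' = 1 \<Longrightarrow>
      cinner e e' = cinner f f' \<Longrightarrow> c e f * cinner (U e) (U e') = c e' f' * cinner (U f) (U f')"
    and u: "norm e = 1" "norm f = 1" "norm h = 1"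
  shows "c e f * c f h = c e h"
proof -
  define T where "T e f h \<longleftrightarrow> c e f * c f h = c e h" for e f h
  have step: "T e f h"
    if "T x y z" and n: "norm e = 1" "norm f = 1" "norm h = 1" "norm x = 1" "norm y = 1" "norm z = 1"
      and eq: "cinner e x = t" "cinner f y = t" "cinner h z = t" and t: "t \<noteq> 0"
    for e f h x y z t
  proof -
    let ?p = "cinner (U e) (U x)" and ?q = "cinner (U f) (U y)" and ?r = "cinner (U h) (U z)"
    have ne: "?p \<noteq> 0" "?q \<noteq> 0" using orth n eq t by auto
    have 1: "c e f * ?p = c x y * ?q" and 2: "c f h * ?q = c y z * ?r" and 3: "c e h * ?p = c x z * ?r"
      using gram n eq by auto
    have "(c e f * c f h) * (?p * ?q) = (c e f * ?p) * (c f h * ?q)" by (simp add: algebra_simps)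
    also have "\<dots> = (c x y * c y z) * ?r * ?q" unfolding 1 2 by (simp add: algebra_simps)
    also have "\<dots> = c e h * (?p * ?q)" using \<open>T x y z\<close> 3 by (simp add: T_def algebra_simps)
    finally show ?thesis using ne by (simp add: T_def)
  qed
  obtain w where w: "\<And>e. norm (w e) = 1" "\<And>e. cinner (w e) e = 0" "\<And>e. cinner (w e) h = 0"
    using dim[of _ h] by metis
  have w': "cinner e (w e) = 0" "cinner h (w e) = 0" for e
    using w cinner_eq_0_commute by blast+
  \<comment> \<open>The coefficients are the legs of a Pythagorean triple, so that norms stay rational.\<close>
  let ?v = "\<lambda>e y. (3/5) *\<^sub>C y + (4/5) *\<^sub>C w e"
  have v: "norm (?v e y) = 1" "cinner y (?v e y) = 3/5" "cinner (?v e y) y = 3/5"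
      "cinner (w e) (?v e y) = 4/5" "cinner (?v e y) (w e) = 4/5"
    if "norm y = 1" "cinner y (w e) = 0" "cinner (w e) y = 0" for e y
  proof -
    have "(norm (?v e y))\<^sup>2 = 1"
      using that cinner_self_unit[OF that(1)] cinner_self_unit[OF w(1)]
      by (simp add: norm_sq_Re_cinner cinner_simps)
    then show "norm (?v e y) = 1" by (rule norm_eq_1_of_square)
  qed (use that cinner_self_unit[OF that(1)] cinner_self_unit[OF w(1)] in \<open>simp_all add: cinner_simps\<close>)
  have "T h h h" using diag[OF u(3)] by (simp add: T_def)
  then have "T (?v e h) (?v f h) (?v h h)"
    by (rule step[where t = "3/5"]) (simp_all only: u v w w' simp_thms, simp_all)
  then have "T (w e) (w f) (w h)"
    by (rule step[where t = "4/5"]) (simp_all only: u v w w' simp_thms, simp_all)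
  then have "T (?v e e) (?v f f) (?v h h)"
    by (rule step[where t = "4/5"]) (simp_all only: u v w w' simp_thms, simp_all)
  then have "T e f h"
    by (rule step[where t = "3/5"]) (simp_all only: u v w w' simp_thms, simp_all)
  then show ?thesis by (simp add: T_def)
qed

section \<open>Parallel vectors and the grid of rank-one operators\<close>

text \<open>For nonzero vectors this means spanning the same line. Stated through orthogonal complements it
  is an equivalence relation on all vectors and transports orthogonality without any scalars.\<close>

definition parallel :: "'a::complex_inner \<Rightarrow> 'a \<Rightarrow> bool" where
  "parallel x y \<longleftrightarrow> (\<forall>z. cinner x z = 0 \<longleftrightarrow> cinner y z = 0)"

lemma parallel_refl [simp]: "parallel x x"
  and parallel_sym: "parallel x y \<Longrightarrow> parallel y x"
  and parallel_trans: "parallel x y \<Longrightarrow> parallel y z \<Longrightarrow> parallel x z"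
  by (auto simp: parallel_def)

lemma parallel_scaleC: "c \<noteq> 0 \<Longrightarrow> parallel (c *\<^sub>C x) x"
  by (simp add: parallel_def cinner_simps)

lemma parallel_orth_cong:
  assumes "parallel x x'" "parallel y y'"
  shows "cinner x y = 0 \<longleftrightarrow> cinner x' y' = 0"
proof -
  have "cinner x y = 0 \<longleftrightarrow> cinner x' y = 0" using assms(1) by (simp add: parallel_def)
  also have "\<dots> \<longleftrightarrow> cinner y x' = 0" by (rule cinner_eq_0_commute)
  also have "\<dots> \<longleftrightarrow> cinner y' x' = 0" using assms(2) by (simp add: parallel_def)
  also have "\<dots> \<longleftrightarrow> cinner x' y' = 0" by (rule cinner_eq_0_commute)
  finally show ?thesis .
qed

lemma orthogonal_not_parallel:
  assumes "norm x = 1" "cinner x y = 0"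
  shows "\<not> parallel x y" "\<not> parallel y x"
  using assms cinner_self_unit[OF assms(1)] cinner_eq_0_commute[of x y]
  by (metis parallel_def zero_neq_one)+

lemma eq_multiple_of_perp_subset:
  fixes x y :: "'a::complex_inner"
  assumes y: "norm y = 1" and perp: "\<And>u. norm u = 1 \<Longrightarrow> cinner u y = 0 \<Longrightarrow> cinner u x = 0"
  shows "x = cinner x y *\<^sub>C y"
proof (rule ccontr)
  define r where "r = x - cinner x y *\<^sub>C y"
  assume "x \<noteq> cinner x y *\<^sub>C y"
  then have r0: "r \<noteq> 0" by (simp add: r_def)
  have ry: "cinner r y = 0" by (simp add: r_def cinner_simps cinner_self_unit[OF y])
  have "cinner (sgn r) x = 0"
    by (rule perp) (use r0 ry in \<open>simp_all add: norm_sgn cinner_sgn_left\<close>)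
  then have "cinner r x = 0" using r0 by (simp add: cinner_sgn_left)
  then have "cinner r (x - cinner x y *\<^sub>C y) = 0" by (simp add: cinner_simps ry)
  then have "cinner r r = 0" by (simp add: r_def)
  then show False using r0 by (simp add: cinner_self)
qed

lemma parallel_unit:
  fixes x y :: "'a::complex_inner"
  assumes y: "norm y = 1" and "parallel x y"
  shows "x = cinner x y *\<^sub>C y"
proof (rule eq_multiple_of_perp_subset[OF y])
  fix u assume "cinner u y = 0"
  then show "cinner u x = 0" using parallel_orth_cong[OF parallel_refl[of u] assms(2)] by simp
qed

lemma parallel_unit_phase:
  fixes x y :: "'a::complex_inner"
  assumes "norm x = 1" "norm y = 1" and "parallel x y"
  shows "cmod (cinner x y) = 1"
  using arg_cong[OF parallel_unit[OF assms(2,3)], of norm] assms by (simp add: norm_scaleC)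

lemma cnj_mult_phase: "cmod c = 1 \<Longrightarrow> cnj c * c = 1" "cmod c = 1 \<Longrightarrow> c * cnj c = 1"
  using complex_norm_square[of c] by (simp_all add: mult.commute)

definition pair_orth :: "'a::complex_inner \<Rightarrow> 'a \<Rightarrow> 'a \<Rightarrow> 'a \<Rightarrow> bool" where
  "pair_orth e f g h \<longleftrightarrow> cinner e g = 0 \<and> cinner f h = 0"

text \<open>The pair \<open>(x, y)\<close> stands for the rank-one operator \<open>rank1 x y\<close>, and the predicate says that it
  lies in the double orthogonal complement of \<open>{rank1 e f, rank1 g h}\<close>.\<close>

definition pair_biorth :: "'a::complex_inner \<Rightarrow> 'a \<Rightarrow> 'a \<Rightarrow> 'a \<Rightarrow> 'a \<Rightarrow> 'a \<Rightarrow> bool" where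
  "pair_biorth e f g h x y \<longleftrightarrow> (\<forall>u v. norm u = 1 \<longrightarrow> norm v = 1 \<longrightarrow>
     pair_orth u v e f \<longrightarrow> pair_orth u v g h \<longrightarrow> pair_orth u v x y)"

lemma pair_biorth_scaleC:
  assumes "c \<noteq> 0"
  shows "pair_biorth e f g h (c *\<^sub>C x) (c *\<^sub>C y) \<longleftrightarrow> pair_biorth e f g h x y"
  using assms by (simp add: pair_biorth_def pair_orth_def cinner_simps)

text \<open>The double orthogonal complement consists of the pairs \<open>(x, y)\<close> with \<open>x\<close> in the span of \<open>e\<close>, \<open>g\<close> and
  \<open>y\<close> in the span of \<open>f\<close>, \<open>h\<close>. It contains two orthogonal pairs precisely if both spans are
  two-dimensional. This expresses the relation of sharing the line of a range or of an initial
  space in terms of orthogonality alone.\<close>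

lemma share_line_iff:
  fixes e f g h :: "'a::complex_inner"
  assumes dim: "\<And>x y :: 'a. \<exists>u. norm u = 1 \<and> cinner u x = 0 \<and> cinner u y = 0"
    and u: "norm e = 1" "norm f = 1" "norm g = 1" "norm h = 1"
  shows "parallel e g \<or> parallel f h \<longleftrightarrow>
    \<not> (\<exists>x y x' y'. norm x = 1 \<and> norm y = 1 \<and> norm x' = 1 \<and> norm y' = 1 \<and>
        pair_biorth e f g h x y \<and> pair_biorth e f g h x' y' \<and> pair_orth x y x' y')"
proof -
  have line: "z = cinner z p *\<^sub>C p"
    if "norm p = 1" "parallel p q" and z: "\<And>u. norm u = 1 \<Longrightarrow> cinner u p = 0 \<Longrightarrow> cinner u q = 0 \<Longrightarrow> cinner u z = 0"
    for p q z :: 'a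
  proof (rule eq_multiple_of_perp_subset[OF that(1)])
    fix u assume "norm u = 1" "cinner u p = 0"
    then show "cinner u z = 0"
      using z parallel_orth_cong[OF parallel_refl[of u] that(2)] by blast
  qed
  have no_orth: "cinner x x' \<noteq> 0"
    if "norm p = 1" "norm x = 1" "norm x' = 1" "x = cinner x p *\<^sub>C p" "x' = cinner x' p *\<^sub>C p" for x x' p :: 'a
  proof -
    have "cinner x p \<noteq> 0" "cinner x' p \<noteq> 0" using that(2-5) by auto
    moreover have "cinner x x' = cinner x p * cnj (cinner x' p)"
      by (subst that(5)) (simp add: cinner_scaleC_right mult.commute)
    ultimately show ?thesis by simp
  qed
  have fst: "x = cinner x e *\<^sub>C e" if "parallel e g" "pair_biorth e f g h x y" for x y
  proof (rule line[OF u(1) that(1)])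
    fix z assume z: "norm z = 1" "cinner z e = 0" "cinner z g = 0"
    obtain v where "norm v = 1" "cinner v f = 0" "cinner v h = 0" using dim by blast
    then show "cinner z x = 0" using that(2) z by (auto simp: pair_biorth_def pair_orth_def)
  qed
  have snd: "y = cinner y f *\<^sub>C f" if "parallel f h" "pair_biorth e f g h x y" for x y
  proof (rule line[OF u(2) that(1)])
    fix z assume z: "norm z = 1" "cinner z f = 0" "cinner z h = 0"
    obtain v where "norm v = 1" "cinner v e = 0" "cinner v g = 0" using dim by blast
    then show "cinner z y = 0" using that(2) z by (auto simp: pair_biorth_def pair_orth_def)
  qed
  have residual: "\<exists>r. norm r = 1 \<and> cinner p r = 0 \<and> (\<forall>u. cinner u p = 0 \<longrightarrow> cinner u q = 0 \<longrightarrow> cinner u r = 0)"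
    if p: "norm p = 1" "norm q = 1" "\<not> parallel p q" for p q :: 'a
  proof -
    define r where "r = q - cinner q p *\<^sub>C p"
    have "r \<noteq> 0"
    proof
      assume "r = 0"
      then have q: "q = cinner q p *\<^sub>C p" by (simp add: r_def)
      then have "cinner q p \<noteq> 0" using p(2) by auto
      then have "parallel q p" using q parallel_scaleC by metis
      then show False using p(3) parallel_sym by blast
    qed
    moreover have "cinner r p = 0" by (simp add: r_def cinner_simps cinner_self_unit[OF p(1)])
    then have "cinner p r = 0" by (simp add: cinner_eq_0_commute)
    moreover have "cinner u r = 0" if "cinner u p = 0" "cinner u q = 0" for u
      using that by (simp add: r_def cinner_simps)
    ultimately show ?thesis
      by (intro exI[of _ "sgn r"]) (simp add: norm_sgn cinner_sgn_right)
  qed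
  show ?thesis
  proof
    assume "parallel e g \<or> parallel f h"
    then show "\<not> (\<exists>x y x' y'. norm x = 1 \<and> norm y = 1 \<and> norm x' = 1 \<and> norm y' = 1 \<and>
        pair_biorth e f g h x y \<and> pair_biorth e f g h x' y' \<and> pair_orth x y x' y')"
      using fst snd no_orth u by (metis pair_orth_def)
  next
    assume *: "\<not> (\<exists>x y x' y'. norm x = 1 \<and> norm y = 1 \<and> norm x' = 1 \<and> norm y' = 1 \<and>
        pair_biorth e f g h x y \<and> pair_biorth e f g h x' y' \<and> pair_orth x y x' y')"
    show "parallel e g \<or> parallel f h"
    proof (rule ccontr)
      assume "\<not> (parallel e g \<or> parallel f h)"
      then obtain r s where r: "norm r = 1" "cinner e r = 0" "\<And>u. cinner u e = 0 \<Longrightarrow> cinner u g = 0 \<Longrightarrow> cinner u r = 0"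
        and s: "norm s = 1" "cinner f s = 0" "\<And>u. cinner u f = 0 \<Longrightarrow> cinner u h = 0 \<Longrightarrow> cinner u s = 0"
        using residual[of e g] residual[of f h] u by metis
      have "pair_biorth e f g h e f" "pair_biorth e f g h r s" "pair_orth e f r s"
        using r s by (auto simp: pair_biorth_def pair_orth_def)
      then show False using * u r(1) s(1) by blast
    qed
  qed
qed

text \<open>The operator \<open>rank1 (A e f) (B e f)\<close> is the image of \<open>rank1 e f\<close> under an automorphism. The
  assumption \<open>compat\<close> renders the existence of common upper bounds. The vectors are chosen only up
  to a common phase, which is why \<open>surj\<close> contains one.\<close>

locale rank1_map =
  fixes A B :: "'a::complex_inner \<Rightarrow> 'a \<Rightarrow> 'a"
  assumes dim: "\<And>x y :: 'a. \<exists>u. norm u = 1 \<and> cinner u x = 0 \<and> cinner u y = 0"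
    and unit: "norm e = 1 \<Longrightarrow> norm f = 1 \<Longrightarrow> norm (A e f) = 1 \<and> norm (B e f) = 1"
    and orth: "norm e = 1 \<Longrightarrow> norm f = 1 \<Longrightarrow> norm g = 1 \<Longrightarrow> norm h = 1 \<Longrightarrow>
      cinner (A e f) (A g h) = 0 \<and> cinner (B e f) (B g h) = 0 \<longleftrightarrow> cinner e g = 0 \<and> cinner f h = 0"
    and compat: "norm e = 1 \<Longrightarrow> norm f = 1 \<Longrightarrow> norm g = 1 \<Longrightarrow> norm h = 1 \<Longrightarrow>
      cinner (A e f) (A g h) = cinner (B e f) (B g h) \<longleftrightarrow> cinner e g = cinner f h"
    and surj: "norm x = 1 \<Longrightarrow> norm y = 1 \<Longrightarrow>
      \<exists>e f c. norm e = 1 \<and> norm f = 1 \<and> cmod c = 1 \<and> A e f = c *\<^sub>C x \<and> B e f = c *\<^sub>C y"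
begin

text \<open>The two symmetries exchange the roles of ranges and initial spaces on the side of the values
  and of the arguments, respectively; they turn statements about rows into statements about
  columns.\<close>

lemma swap_lines: "rank1_map B A"
proof
  show "\<exists>u. norm u = 1 \<and> cinner u x = 0 \<and> cinner u y = 0" for x y :: 'a by (rule dim)
  show "norm (B e f) = 1 \<and> norm (A e f) = 1" if "norm e = 1" "norm f = 1" for e f
    using unit[OF that] by simp
  show "cinner (B e f) (B g h) = 0 \<and> cinner (A e f) (A g h) = 0 \<longleftrightarrow> cinner e g = 0 \<and> cinner f h = 0"
    if "norm e = 1" "norm f = 1" "norm g = 1" "norm h = 1" for e f g h
    using orth[OF that] by blast
  show "cinner (B e f) (B g h) = cinner (A e f) (A g h) \<longleftrightarrow> cinner e g = cinner f h"
    if "norm e = 1" "norm f = 1" "norm g = 1" "norm h = 1" for e f g h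
    using compat[OF that] by auto
  show "\<exists>e f c. norm e = 1 \<and> norm f = 1 \<and> cmod c = 1 \<and> B e f = c *\<^sub>C x \<and> A e f = c *\<^sub>C y"
    if "norm x = 1" "norm y = 1" for x y
    using surj[OF that(2,1)] by blast
qed

lemma swap_arguments: "rank1_map (\<lambda>f e. A e f) (\<lambda>f e. B e f)"
proof
  show "\<exists>u. norm u = 1 \<and> cinner u x = 0 \<and> cinner u y = 0" for x y :: 'a by (rule dim)
  show "norm (A f e) = 1 \<and> norm (B f e) = 1" if "norm e = 1" "norm f = 1" for e f
    using unit[OF that(2,1)] .
  show "cinner (A f e) (A h g) = 0 \<and> cinner (B f e) (B h g) = 0 \<longleftrightarrow> cinner e g = 0 \<and> cinner f h = 0"
    if "norm e = 1" "norm f = 1" "norm g = 1" "norm h = 1" for e f g h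
    using orth[OF that(2,1,4,3)] by blast
  show "cinner (A f e) (A h g) = cinner (B f e) (B h g) \<longleftrightarrow> cinner e g = cinner f h"
    if "norm e = 1" "norm f = 1" "norm g = 1" "norm h = 1" for e f g h
    using compat[OF that(2,1,4,3)] by auto
  show "\<exists>e f c. norm e = 1 \<and> norm f = 1 \<and> cmod c = 1 \<and> A f e = c *\<^sub>C x \<and> B f e = c *\<^sub>C y"
    if "norm x = 1" "norm y = 1" for x y
    using surj[OF that] by blast
qed

lemma pair_orth_map:
  assumes "norm e = 1" "norm f = 1" "norm g = 1" "norm h = 1"
  shows "pair_orth (A e f) (B e f) (A g h) (B g h) \<longleftrightarrow> pair_orth e f g h"
  using orth[OF assms] by (simp add: pair_orth_def)

lemma pair_biorth_map:
  assumes n: "norm e = 1" "norm f = 1" "norm g = 1" "norm h = 1" "norm x = 1" "norm y = 1"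
  shows "pair_biorth (A e f) (B e f) (A g h) (B g h) (A x y) (B x y) \<longleftrightarrow> pair_biorth e f g h x y"
proof
  assume *: "pair_biorth (A e f) (B e f) (A g h) (B g h) (A x y) (B x y)"
  show "pair_biorth e f g h x y"
    unfolding pair_biorth_def
  proof (intro allI impI)
    fix u v assume "norm u = 1" "norm v = 1" "pair_orth u v e f" "pair_orth u v g h"
    then show "pair_orth u v x y"
      using *[unfolded pair_biorth_def, rule_format, of "A u v" "B u v"] n
      by (simp add: pair_orth_map unit)
  qed
next
  assume *: "pair_biorth e f g h x y"
  show "pair_biorth (A e f) (B e f) (A g h) (B g h) (A x y) (B x y)"
    unfolding pair_biorth_def
  proof (intro allI impI)
    fix u v
    assume uv: "norm u = 1" "norm v = 1" "pair_orth u v (A e f) (B e f)" "pair_orth u v (A g h) (B g h)"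
    obtain p q c where pq: "norm p = 1" "norm q = 1" "cmod c = 1" "A p q = c *\<^sub>C u" "B p q = c *\<^sub>C v"
      using surj[OF uv(1,2)] by blast
    have c: "pair_orth u v z w \<longleftrightarrow> pair_orth (A p q) (B p q) z w" for z w
      using pq(3) by (auto simp: pq(4,5) pair_orth_def cinner_simps)
    show "pair_orth u v (A x y) (B x y)"
      using * uv(3,4) pq(1,2) n unfolding c by (simp add: pair_orth_map) (simp add: pair_biorth_def)
  qed
qed

lemma share_line_map:
  assumes n: "norm e = 1" "norm f = 1" "norm g = 1" "norm h = 1"
  shows "parallel (A e f) (A g h) \<or> parallel (B e f) (B g h) \<longleftrightarrow> parallel e g \<or> parallel f h"
proof -
  let ?Q = "\<lambda>e f g h x y x' y' :: 'a. norm x = 1 \<and> norm y = 1 \<and> norm x' = 1 \<and> norm y' = 1 \<and>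
        pair_biorth e f g h x y \<and> pair_biorth e f g h x' y' \<and> pair_orth x y x' y'"
  have "(\<exists>x y x' y'. ?Q (A e f) (B e f) (A g h) (B g h) x y x' y') \<longleftrightarrow> (\<exists>x y x' y'. ?Q e f g h x y x' y')"
  proof
    assume "\<exists>x y x' y'. ?Q e f g h x y x' y'"
    then obtain x y x' y' where "?Q e f g h x y x' y'" by blast
    then have "?Q (A e f) (B e f) (A g h) (B g h) (A x y) (B x y) (A x' y') (B x' y')"
      using n by (simp add: pair_biorth_map pair_orth_map unit)
    then show "\<exists>x y x' y'. ?Q (A e f) (B e f) (A g h) (B g h) x y x' y'" by blast
  next
    assume "\<exists>x y x' y'. ?Q (A e f) (B e f) (A g h) (B g h) x y x' y'"
    then obtain x y x' y' where Q: "?Q (A e f) (B e f) (A g h) (B g h) x y x' y'" by blast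
    obtain p q c where p: "norm p = 1" "norm q = 1" "cmod c = 1" "A p q = c *\<^sub>C x" "B p q = c *\<^sub>C y"
      using surj[of x y] Q by blast
    obtain p' q' c' where p': "norm p' = 1" "norm q' = 1" "cmod c' = 1" "A p' q' = c' *\<^sub>C x'" "B p' q' = c' *\<^sub>C y'"
      using surj[of x' y'] Q by blast
    have c: "c \<noteq> 0" "c' \<noteq> 0" using p(3) p'(3) by auto
    have "pair_biorth (A e f) (B e f) (A g h) (B g h) (A p q) (B p q)"
      "pair_biorth (A e f) (B e f) (A g h) (B g h) (A p' q') (B p' q')"
      "pair_orth (A p q) (B p q) (A p' q') (B p' q')"
      unfolding p(4,5) p'(4,5) pair_biorth_scaleC[OF c(1)] pair_biorth_scaleC[OF c(2)]
      using Q c by (simp_all add: pair_orth_def cinner_simps)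
    then have "?Q e f g h p q p' q'" using n p(1,2) p'(1,2) by (simp add: pair_biorth_map pair_orth_map)
    then show "\<exists>x y x' y'. ?Q e f g h x y x' y'" by blast
  qed
  then show ?thesis
    using share_line_iff[OF dim n] share_line_iff[OF dim, of "A e f" "B e f" "A g h" "B g h"] unit n
    by simp
qed

text \<open>An image parallel in both components shares lines with exactly the same images, so the arguments
  share lines with the same pairs. Testing against \<open>(e, y)\<close> with \<open>y\<close> orthogonal to \<open>f\<close> and \<open>h\<close> isolates
  the first component.\<close>

lemma both_parallel_imp:
  assumes n: "norm e = 1" "norm f = 1" "norm g = 1" "norm h = 1"
    and p: "parallel (A e f) (A g h)" "parallel (B e f) (B g h)"
  shows "parallel e g" "parallel f h"
proof -
  have iff: "parallel e x \<or> parallel f y \<longleftrightarrow> parallel g x \<or> parallel h y" if "norm x = 1" "norm y = 1" for x y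
  proof -
    have "parallel (A e f) (A x y) \<longleftrightarrow> parallel (A g h) (A x y)"
      "parallel (B e f) (B x y) \<longleftrightarrow> parallel (B g h) (B x y)"
      using p parallel_sym parallel_trans by blast+
    then show ?thesis using share_line_map n that by metis
  qed
  obtain y where y: "norm y = 1" "cinner y f = 0" "cinner y h = 0" using dim by blast
  show "parallel e g"
    using iff[OF n(1) y(1)] orthogonal_not_parallel(2)[OF y(1,3)] parallel_sym by auto
  obtain x where x: "norm x = 1" "cinner x e = 0" "cinner x g = 0" using dim by blast
  show "parallel f h"
    using iff[OF x(1) n(2)] orthogonal_not_parallel(2)[OF x(1,3)] parallel_sym by auto
qed

text \<open>Call the pairs with a fixed first component \<open>e\<close> a row. If \<open>(e, f)\<close> were mapped outside the row
  containing the images of \<open>(e, f1)\<close> and \<open>(e, f2)\<close>, it would have to share its second component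
  with both of these images, which would then coincide.\<close>

lemma row_first:
  assumes n: "norm e = 1" "norm f1 = 1" "norm f2 = 1" "norm f = 1"
    and np: "\<not> parallel f1 f2" and p: "parallel (A e f1) (A e f2)"
  shows "parallel (A e f) (A e f1)"
proof (rule ccontr)
  assume no: "\<not> parallel (A e f) (A e f1)"
  then have "\<not> parallel (A e f) (A e f2)" using p parallel_trans parallel_sym by blast
  moreover have "parallel (A e f) (A e f1) \<or> parallel (B e f) (B e f1)"
    "parallel (A e f) (A e f2) \<or> parallel (B e f) (B e f2)"
    using share_line_map[OF n(1,4,1,2)] share_line_map[OF n(1,4,1,3)] by simp_all
  ultimately have "parallel (B e f1) (B e f2)" using no parallel_trans parallel_sym by blast
  then show False using both_parallel_imp(2)[OF n(1,2,1,3) p] np by blast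
qed

definition row_to_row :: "'a \<Rightarrow> bool" where
  "row_to_row e \<longleftrightarrow> (\<forall>f f'. norm f = 1 \<longrightarrow> norm f' = 1 \<longrightarrow> parallel (A e f) (A e f'))"

lemma row_to_rowI:
  assumes n: "norm e = 1" "norm f1 = 1" "norm f2 = 1"
    and np: "\<not> parallel f1 f2" and p: "parallel (A e f1) (A e f2)"
  shows "row_to_row e"
  unfolding row_to_row_def using row_first[OF n _ np p] parallel_trans parallel_sym by blast

lemma row_cases:
  assumes e: "norm e = 1"
  shows "row_to_row e \<or> rank1_map.row_to_row B e"
proof -
  interpret S: rank1_map B A by (rule swap_lines)
  obtain y where y: "norm y = 1" "cinner y e = 0" using dim by blast
  have np: "\<not> parallel e y" by (rule orthogonal_not_parallel(2)[OF y])
  have "parallel (A e e) (A e y) \<or> parallel (B e e) (B e y)"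
    using share_line_map[OF e e e y(1)] by simp
  then show ?thesis using row_to_rowI[OF e e y(1) np] S.row_to_rowI[OF e e y(1) np] by blast
qed

text \<open>Suppose the row of \<open>e\<close> is mapped into a row and the row of \<open>e'\<close> into a column. For each \<open>f\<close> the
  images of \<open>(e, f)\<close> and \<open>(e', f)\<close> share a line. Among three mutually orthogonal choices of \<open>f\<close>, two
  share the same kind of line, and then two distinct pairs in one of the two rows have the same
  image.\<close>

lemma rows_same_type:
  assumes n: "norm e = 1" "norm e' = 1" and row: "row_to_row e"
  shows "row_to_row e'"
proof (rule ccontr)
  interpret S: rank1_map B A by (rule swap_lines)
  assume "\<not> row_to_row e'"
  then have row': "S.row_to_row e'" using row_cases[OF n(2)] by blast
  obtain y where y: "norm y = 1" "cinner y e = 0" using dim by blast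
  obtain z where z: "norm z = 1" "cinner z e = 0" "cinner z y = 0" using dim by blast
  have np: "\<not> parallel e y" "\<not> parallel e z" "\<not> parallel y z"
    using orthogonal_not_parallel(2) y z by blast+
  have share: "parallel (A e f) (A e' f) \<or> parallel (B e f) (B e' f)" if "norm f = 1" for f
    using share_line_map[OF n(1) that n(2) that] by simp
  have A: False if f: "norm f = 1" "norm f' = 1" "\<not> parallel f f'"
      and "parallel (A e f) (A e' f)" "parallel (A e f') (A e' f')" for f f'
  proof -
    have "parallel (A e f) (A e f')" using row f by (simp add: row_to_row_def)
    then have "parallel (A e' f) (A e' f')" using that(4,5) parallel_trans parallel_sym by blast
    moreover have "parallel (B e' f) (B e' f')" using row' f by (simp add: S.row_to_row_def)
    ultimately show False using both_parallel_imp(2)[OF n(2) f(1) n(2) f(2)] f(3) by blast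
  qed
  have B: False if f: "norm f = 1" "norm f' = 1" "\<not> parallel f f'"
      and "parallel (B e f) (B e' f)" "parallel (B e f') (B e' f')" for f f'
  proof -
    have "parallel (B e' f) (B e' f')" using row' f by (simp add: S.row_to_row_def)
    then have "parallel (B e f) (B e f')" using that(4,5) parallel_trans parallel_sym by blast
    moreover have "parallel (A e f) (A e f')" using row f by (simp add: row_to_row_def)
    ultimately show False using both_parallel_imp(2)[OF n(1) f(1) n(1) f(2)] f(3) by blast
  qed
  show False using share[OF n(1)] share[OF y(1)] share[OF z(1)] A B np n y z by metis
qed

definition straight :: bool where
  "straight \<longleftrightarrow>
    (\<forall>e f f'. norm e = 1 \<longrightarrow> norm f = 1 \<longrightarrow> norm f' = 1 \<longrightarrow> parallel (A e f) (A e f')) \<and>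
    (\<forall>e e' f. norm e = 1 \<longrightarrow> norm e' = 1 \<longrightarrow> norm f = 1 \<longrightarrow> parallel (B e f) (B e' f))"

text \<open>If rows and columns were all mapped into rows, all images would lie in one row and no two of them
  could be orthogonal.\<close>

lemma straightI:
  assumes e: "norm e = 1" and row: "row_to_row e"
  shows "straight"
proof -
  interpret C: rank1_map "\<lambda>f e. A e f" "\<lambda>f e. B e f" by (rule swap_arguments)
  interpret D: rank1_map "\<lambda>f e. B e f" "\<lambda>f e. A e f" by (rule C.swap_lines)
  have rows: "row_to_row e'" if "norm e' = 1" for e' using rows_same_type[OF e that row] .
  have "\<not> C.row_to_row e"
  proof
    assume col: "C.row_to_row e"
    obtain y where y: "norm y = 1" "cinner y e = 0" using dim by blast
    have "parallel (A e e) (A y e)" using col e y by (simp add: C.row_to_row_def)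
    moreover have "parallel (A y e) (A y y)" using rows[OF y(1)] e y by (simp add: row_to_row_def)
    ultimately have "parallel (A y y) (A e e)" using parallel_trans parallel_sym by blast
    moreover have "cinner (A y y) (A e e) = 0" using orth[of y y e e] e y by simp
    ultimately show False using orthogonal_not_parallel unit[OF y(1) y(1)] by blast
  qed
  then have "D.row_to_row e" using C.row_cases[OF e] by blast
  then have cols: "D.row_to_row f" if "norm f = 1" for f using D.rows_same_type[OF e that] by blast
  show ?thesis
    using rows cols by (auto simp: straight_def row_to_row_def D.row_to_row_def)
qed

lemma straight_cases: "straight \<or> rank1_map.straight B A"
proof -
  interpret S: rank1_map B A by (rule swap_lines)
  obtain e :: 'a where e: "norm e = 1" using dim by blast
  show ?thesis using row_cases[OF e] straightI[OF e] S.straightI[OF e] by blast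
qed

text \<open>The vectors \<open>U e\<close> and \<open>V f\<close> fix the phases such that the image of \<open>rank1 e f0\<close> is
  \<open>rank1 (U e) (V f0)\<close> and that of \<open>rank1 f f\<close> is \<open>rank1 (U f) (V f)\<close>. In general the image of
  \<open>rank1 e f\<close> is \<open>c e f\<close> times \<open>rank1 (U e) (V f)\<close> with a phase \<open>c e f\<close>. Compatibility of the operators
  \<open>rank1 e e\<close> shows that \<open>U\<close> and \<open>V\<close> have equal Gram matrices. Compatibility in general is the
  hypothesis of the cocycle identity for \<open>c\<close>, and \<open>c e f0 = 1\<close> then makes \<open>c\<close> constant.\<close>

lemma straight_factor:
  assumes straight
  obtains U V where
    "\<And>e. norm e = 1 \<Longrightarrow> norm (U e) = 1" "\<And>f. norm f = 1 \<Longrightarrow> norm (V f) = 1"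
    "\<And>e f. norm e = 1 \<Longrightarrow> norm f = 1 \<Longrightarrow> \<exists>c. cmod c = 1 \<and> A e f = c *\<^sub>C U e \<and> B e f = c *\<^sub>C V f"
    "\<And>e f. norm e = 1 \<Longrightarrow> norm f = 1 \<Longrightarrow> cinner (U e) (U f) = cinner (V e) (V f)"
    "\<And>e f. norm e = 1 \<Longrightarrow> norm f = 1 \<Longrightarrow> cinner (U e) (U f) = 0 \<longleftrightarrow> cinner e f = 0"
    "\<And>e f e' f'. norm e = 1 \<Longrightarrow> norm f = 1 \<Longrightarrow> norm e' = 1 \<Longrightarrow> norm f' = 1 \<Longrightarrow>
      cinner e e' = cinner f f' \<Longrightarrow> cinner (U e) (U e') = cinner (U f) (U f')"
proof -
  have parA: "parallel (A e f) (A e f')" and parB: "parallel (B e f) (B e' f)"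
    if "norm e = 1" "norm e' = 1" "norm f = 1" "norm f' = 1" for e e' f f'
    using assms that by (auto simp: straight_def)
  obtain f0 :: 'a where f0: "norm f0 = 1" using dim by blast
  define U where "U e = cnj (cinner (B e f0) (B f0 f0)) *\<^sub>C A e f0" for e
  define V where "V f = cnj (cinner (A f f) (U f)) *\<^sub>C B f f" for f
  have phB: "cmod (cinner (B e f0) (B f0 f0)) = 1" if "norm e = 1" for e
    using that f0 unit parB by (intro parallel_unit_phase) auto
  have nU: "norm (U e) = 1" if "norm e = 1" for e
    using phB[OF that] unit[OF that f0] by (simp add: U_def norm_scaleC)
  have AU: "parallel (A e f) (U e)" if "norm e = 1" "norm f = 1" for e f
  proof -
    have "cnj (cinner (B e f0) (B f0 f0)) \<noteq> 0" using phB[OF that(1)] by auto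
    then have "parallel (U e) (A e f0)" unfolding U_def by (rule parallel_scaleC)
    then show ?thesis using parA[OF that(1) that(1) f0 that(2)] parallel_trans parallel_sym by blast
  qed
  have phA: "cmod (cinner (A e f) (U e)) = 1" if "norm e = 1" "norm f = 1" for e f
    using that unit nU AU by (intro parallel_unit_phase) auto
  have nV: "norm (V f) = 1" if "norm f = 1" for f
    using phA[OF that that] unit[OF that that] by (simp add: V_def norm_scaleC)
  have BV: "parallel (B e f) (V f)" if "norm e = 1" "norm f = 1" for e f
  proof -
    have "cnj (cinner (A f f) (U f)) \<noteq> 0" using phA[OF that(2) that(2)] by auto
    then have "parallel (V f) (B f f)" unfolding V_def by (rule parallel_scaleC)
    then show ?thesis using parB[OF that that(2,2)] parallel_trans parallel_sym by blast
  qed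
  have phBV: "cmod (cinner (B e f) (V f)) = 1" if "norm e = 1" "norm f = 1" for e f
    using that unit nV BV by (intro parallel_unit_phase) auto
  have A: "A e f = cinner (A e f) (U e) *\<^sub>C U e" if "norm e = 1" "norm f = 1" for e f
    using parallel_unit[OF nU AU] that by blast
  have B: "B e f = cinner (B e f) (V f) *\<^sub>C V f" if "norm e = 1" "norm f = 1" for e f
    using parallel_unit[OF nV BV] that by blast
  define c where "c e f = cinner (A e f) (U e) * cnj (cinner (B e f) (V f))" for e f
  have gramUV: "c e f * cinner (U e) (U e') = c e' f' * cinner (V f) (V f')"
    if n: "norm e = 1" "norm f = 1" "norm e' = 1" "norm f' = 1" and "cinner e e' = cinner f f'" for e f e' f'
  proof -
    define p q p' q' where "p = cinner (A e f) (U e)" and "q = cinner (B e f) (V f)"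
      and "p' = cinner (A e' f') (U e')" and "q' = cinner (B e' f') (V f')"
    have "cinner (A e f) (A e' f') = cinner (B e f) (B e' f')" using compat[OF n(1,2,3,4)] that(5) by blast
    then have eq: "p * cnj p' * cinner (U e) (U e') = q * cnj q' * cinner (V f) (V f')"
      unfolding p_def q_def p'_def q'_def
      by (subst (asm) A[OF n(1,2)], subst (asm) A[OF n(3,4)], subst (asm) B[OF n(1,2)], subst (asm) B[OF n(3,4)])
         (simp add: cinner_scaleC_left cinner_scaleC_right ac_simps)
    have ph: "cnj p' * p' = 1" "cnj q * q = 1"
      using phA[OF n(3,4)] phBV[OF n(1,2)] by (auto simp: p'_def q_def cnj_mult_phase)
    have "p * cnj q * cinner (U e) (U e') = cnj q * p' * (p * cnj p' * cinner (U e) (U e'))"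
      using ph(1) by (simp add: algebra_simps)
    also have "\<dots> = p' * cnj q' * cinner (V f) (V f')"
      unfolding eq using ph(2) by (simp add: algebra_simps)
    finally show ?thesis by (simp add: c_def p_def q_def p'_def q'_def)
  qed
  have diag: "c e e = 1" if "norm e = 1" for e
    using unit[OF that that] phA[OF that that] cnj_mult_phase[OF phA[OF that that]]
    by (simp add: c_def V_def cinner_scaleC_right cinner_self_unit)
  have V0: "V f0 = B f0 f0"
    using unit[OF f0 f0] f0 by (simp add: V_def U_def cinner_self_unit)
  have c0: "c e f0 = 1" if "norm e = 1" for e
    using unit[OF that f0] cnj_mult_phase[OF phB[OF that]]
    by (simp add: c_def V0 U_def cinner_scaleC_right cinner_self_unit)
  have UV: "cinner (U e) (U f) = cinner (V e) (V f)" if "norm e = 1" "norm f = 1" for e f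
    using gramUV[of e e f f] that diag by simp
  have Uorth: "cinner (U e) (U f) = 0 \<longleftrightarrow> cinner e f = 0" if n: "norm e = 1" "norm f = 1" for e f
  proof -
    have orth0: "cinner (U p) (U q) = 0 \<longleftrightarrow> cinner (A p r) (A q s) = 0"
      "cinner (V r) (V s) = 0 \<longleftrightarrow> cinner (B p r) (B q s) = 0"
      if "norm p = 1" "norm q = 1" "norm r = 1" "norm s = 1" for p q r s
      using parallel_orth_cong[OF AU AU] parallel_orth_cong[OF BV BV] that by blast+
    have imp: "cinner (U p) (U q) = 0" if "norm p = 1" "norm q = 1" "cinner p q = 0" for p q
      using orth0(1)[of p q p q] orth[of p p q q] that by simp
    obtain y where y: "norm y = 1" "cinner y e = 0" using dim by blast
    have "cinner (V y) (V e) = 0" using imp[OF y(1) n(1) y(2)] UV[OF y(1) n(1)] by simp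
    then have "cinner (B e y) (B f e) = 0" using orth0(2)[OF n(1,2) y(1) n(1)] by simp
    then show ?thesis
      using orth0(1)[OF n y(1) n(1)] orth[OF n(1) y(1) n(2) n(1)] imp n by blast
  qed
  have c1: "c e f = 1" if "norm e = 1" "norm f = 1" for e f
  proof -
    have "c e f * c f f0 = c e f0"
    proof (rule cocycle_identity[where U = U])
      show "c e f * cinner (U e) (U e') = c e' f' * cinner (U f) (U f')"
        if "norm e = 1" "norm f = 1" "norm e' = 1" "norm f' = 1" "cinner e e' = cinner f f'" for e f e' f'
        using gramUV[OF that] UV[OF that(2,4)] by simp
    qed (use dim Uorth diag that f0 in auto)
    then show ?thesis using c0 that by simp
  qed
  show ?thesis
  proof (rule that[OF nU nV _ UV Uorth])
    show "\<exists>c. cmod c = 1 \<and> A e f = c *\<^sub>C U e \<and> B e f = c *\<^sub>C V f" if "norm e = 1" "norm f = 1" for e f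
    proof -
      let ?q = "cinner (B e f) (V f)"
      have "cinner (A e f) (U e) = cinner (A e f) (U e) * (cnj ?q * ?q)"
        using cnj_mult_phase[OF phBV[OF that]] by simp
      also have "\<dots> = ?q" using c1[OF that] by (simp add: c_def flip: mult.assoc)
      finally show ?thesis using A[OF that] B[OF that] phA[OF that] by metis
    qed
    show "cinner (U e) (U e') = cinner (U f) (U f')"
      if "norm e = 1" "norm f = 1" "norm e' = 1" "norm f' = 1" "cinner e e' = cinner f f'" for e f e' f'
      using gramUV[OF that] c1 UV[OF that(2,4)] that by simp
  qed auto
qed

end

section \<open>Three dimensions\<close>

lemma orthonormal3_exists:
  assumes "hilbert_dim_ge TYPE('h::chilbert_space) 3"
  obtains x y z :: "'h::chilbert_space" where "orthonormal3 x y z"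
proof -
  obtain B :: "'h set" where B: "orthonormal_basis B" "infinite B \<or> 3 \<le> card B"
    using assms by (auto simp: hilbert_dim_ge_def)
  then obtain T where T: "T \<subseteq> B" "card T = 3"
    using infinite_arbitrarily_large[of B 3] obtain_subset_with_card_n[of 3 B] by metis
  then obtain x y z where "T = {x, y, z}" "x \<noteq> y" "x \<noteq> z" "y \<noteq> z"
    by (auto simp: card_3_iff)
  then have "orthonormal3 x y z"
    using B(1) T(1) by (auto simp: orthonormal3_def orthonormal_basis_def)
  then show ?thesis by (rule that)
qed

text \<open>The cross product of the coefficient vectors is a solution; if it vanishes, the equations are
  dependent and a solution of one nontrivial equation suffices.\<close>

lemma two_equations_three_unknowns:
  fixes p1 p2 p3 q1 q2 q3 :: complex
  shows "\<exists>a1 a2 a3. (a1 \<noteq> 0 \<or> a2 \<noteq> 0 \<or> a3 \<noteq> 0) \<and>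
    a1 * p1 + a2 * p2 + a3 * p3 = 0 \<and> a1 * q1 + a2 * q2 + a3 * q3 = 0"
    (is "\<exists>a1 a2 a3. ?P a1 a2 a3")
proof (cases "p2 * q3 = p3 * q2 \<and> p3 * q1 = p1 * q3 \<and> p1 * q2 = p2 * q1")
  case False
  then have "?P (p2 * q3 - p3 * q2) (p3 * q1 - p1 * q3) (p1 * q2 - p2 * q1)"
    by (auto simp: algebra_simps)
  then show ?thesis by blast
next
  case True
  then have "?P p2 (- p1) 0 \<or> ?P p3 0 (- p1) \<or> ?P 0 p3 (- p2) \<or>
      ?P q2 (- q1) 0 \<or> ?P q3 0 (- q1) \<or> ?P 0 q3 (- q2) \<or> ?P 1 0 0"
    by (cases "p1 = 0"; cases "p2 = 0"; cases "p3 = 0"; cases "q1 = 0") (auto simp: algebra_simps)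
  then show ?thesis by metis
qed

lemma unit_orthogonal_to_two:
  fixes x y b1 b2 b3 :: "'a::complex_inner"
  assumes b: "orthonormal3 b1 b2 b3"
  shows "\<exists>u. norm u = 1 \<and> cinner u x = 0 \<and> cinner u y = 0"
proof -
  obtain a1 a2 a3 where a: "a1 \<noteq> 0 \<or> a2 \<noteq> 0 \<or> a3 \<noteq> 0"
    "a1 * cinner b1 x + a2 * cinner b2 x + a3 * cinner b3 x = 0"
    "a1 * cinner b1 y + a2 * cinner b2 y + a3 * cinner b3 y = 0"
    using two_equations_three_unknowns by metis
  define v where "v = a1 *\<^sub>C b1 + a2 *\<^sub>C b2 + a3 *\<^sub>C b3"
  have "cinner v b1 = a1" "cinner v b2 = a2" "cinner v b3 = a3"
    by (simp_all add: v_def cinner_simps orthonormal3D[OF b])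
  then have "v \<noteq> 0" using a(1) by auto
  moreover have "cinner v x = 0" "cinner v y = 0" using a(2,3) by (simp_all add: v_def cinner_simps)
  ultimately show ?thesis
    by (intro exI[of _ "sgn v"]) (simp add: norm_sgn cinner_sgn_left)
qed

section \<open>Unitary and antiunitary operators from Gram matrices\<close>

text \<open>Unitary operators are the case in which \<open>\<sigma>\<close> is the identity, antiunitary operators the case
  \<open>\<sigma> = cnj\<close>; the common form avoids proving everything twice.\<close>

definition semi_unitary :: "(complex \<Rightarrow> complex) \<Rightarrow> ('a::chilbert_space \<Rightarrow>\<^sub>L 'a) \<Rightarrow> bool" where
  "semi_unitary \<sigma> T \<longleftrightarrow> (\<forall>x y. cinner (T x) (T y) = \<sigma> (cinner x y)) \<and>
     (\<forall>c x. T (c *\<^sub>C x) = \<sigma> c *\<^sub>C T x) \<and> surj (blinfun_apply T)"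

lemma semi_unitaryD:
  assumes "semi_unitary \<sigma> T"
  shows "cinner (T x) (T y) = \<sigma> (cinner x y)" "T (c *\<^sub>C x) = \<sigma> c *\<^sub>C T x"
    "surj (blinfun_apply T)"
  using assms by (auto simp: semi_unitary_def)

lemma semi_unitary_norm:
  assumes \<sigma>: "\<sigma> = (\<lambda>z. z) \<or> \<sigma> = cnj" and T: "semi_unitary \<sigma> T"
  shows "norm (T x) = norm x"
proof -
  have "(norm (T x))\<^sup>2 = (norm x)\<^sup>2"
    using \<sigma> semi_unitaryD(1)[OF T, of x x] by (auto simp: norm_sq_Re_cinner)
  then show ?thesis by (simp add: power2_eq_iff_nonneg)
qed

lemma semi_unitary_inj:
  assumes \<sigma>: "\<sigma> = (\<lambda>z. z) \<or> \<sigma> = cnj" and T: "semi_unitary \<sigma> T"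
  shows "inj (blinfun_apply T)"
proof (rule injI)
  fix x y assume "T x = T y"
  then have "norm (T (x - y)) = 0" by (simp add: blinfun.diff_right)
  then show "x = y" using semi_unitary_norm[OF assms] by simp
qed

lemma semi_unitary_id: "semi_unitary (\<lambda>z. z) T \<Longrightarrow> unitary T"
  using semi_unitary_norm[of "\<lambda>z. z" T] semi_unitary_inj[of "\<lambda>z. z" T] semi_unitaryD[of "\<lambda>z. z" T]
  by (auto simp: unitary_def complex_linear_op_iff bij_def)

lemma semi_unitary_cnj: "semi_unitary cnj T \<Longrightarrow> antiunitary T"
  using semi_unitary_norm[of cnj T] semi_unitary_inj[of cnj T] semi_unitaryD[of cnj T]
  by (auto simp: antiunitary_def conjugate_linear_op_def bij_def blinfun.add_right)

lemma semi_unitary_cases: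
  assumes "\<sigma> = (\<lambda>z. z) \<or> \<sigma> = cnj" "semi_unitary \<sigma> U" "semi_unitary \<sigma> V"
  shows "unitary U \<and> unitary V \<or> antiunitary U \<and> antiunitary V"
  using assms by (auto intro: semi_unitary_id semi_unitary_cnj)

text \<open>Extend \<open>W\<close> from the unit sphere by positive homogeneity. The defects of additivity and of
  homogeneity are combinations of values of the extension, and the Gram identity shows that they
  are orthogonal to all of these values, so they vanish.\<close>

lemma semi_unitary_extension:
  fixes W :: "'a::chilbert_space \<Rightarrow> 'a"
  assumes \<sigma>: "\<sigma> = (\<lambda>z. z) \<or> \<sigma> = cnj"
    and gram: "\<And>e f. norm e = 1 \<Longrightarrow> norm f = 1 \<Longrightarrow> cinner (W e) (W f) = \<sigma> (cinner e f)"
    and surj: "\<And>g. norm g = 1 \<Longrightarrow> \<exists>e c. norm e = 1 \<and> g = c *\<^sub>C W e"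
  obtains T where "semi_unitary \<sigma> T" "\<And>e. norm e = 1 \<Longrightarrow> T e = W e"
proof -
  have \<sigma>_simps: "\<sigma> (of_real r) = of_real r" "\<sigma> (z * w) = \<sigma> z * \<sigma> w" "\<sigma> (z + w) = \<sigma> z + \<sigma> w"
    "\<sigma> (\<sigma> z) = z" "\<sigma> (cnj z) = cnj (\<sigma> z)" "cmod (\<sigma> z) = cmod z" "\<sigma> 0 = 0" for r z w
    using \<sigma> by auto
  define t where "t x = complex_of_real (norm x) *\<^sub>C W (sgn x)" for x
  have t: "cinner (t x) (t y) = \<sigma> (cinner x y)" for x y
  proof (cases "x = 0 \<or> y = 0")
    case True
    then show ?thesis by (auto simp: t_def \<sigma>_simps)
  next
    case False
    then have "cinner (t x) (t y) = of_real (norm x) * (of_real (norm y) * \<sigma> (cinner (sgn x) (sgn y)))"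
      by (simp add: t_def cinner_simps gram norm_sgn)
    also have "\<dots> = \<sigma> (of_real (norm x) * (of_real (norm y) * cinner (sgn x) (sgn y)))"
      by (simp add: \<sigma>_simps)
    also have "\<dots> = \<sigma> (cinner x y)"
    proof -
      have "of_real (norm x) * (of_real (norm y) * cinner (sgn x) (sgn y)) = cinner x y"
        using False by (simp add: cinner_sgn_left cinner_sgn_right field_simps)
      then show ?thesis by simp
    qed
    finally show ?thesis .
  qed
  have t_add: "t (x + y) = t x + t y" for x y
  proof -
    define r where "r = t (x + y) - t x - t y"
    have "cinner r (t z) = 0" for z
      by (simp add: r_def t cinner_simps \<sigma>_simps)
    then have "cinner r r = 0" by (subst (2) r_def) (simp add: cinner_simps)
    then show ?thesis by (simp add: r_def cinner_self algebra_simps)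
  qed
  have t_scale: "t (c *\<^sub>C x) = \<sigma> c *\<^sub>C t x" for c x
  proof -
    define r where "r = t (c *\<^sub>C x) - \<sigma> c *\<^sub>C t x"
    have "cinner r (t z) = 0" for z
      by (simp add: r_def t cinner_simps \<sigma>_simps)
    then have "cinner r r = 0" by (subst (2) r_def) (simp add: cinner_simps)
    then show ?thesis by (simp add: r_def cinner_self)
  qed
  have tW: "t e = W e" if "norm e = 1" for e using that by (simp add: t_def sgn_div_norm)
  have t_norm: "norm (t x) = norm x" for x
  proof -
    have "(norm (t x))\<^sup>2 = (norm x)\<^sup>2" using t[of x x] \<sigma> by (auto simp: norm_sq_Re_cinner)
    then show ?thesis by (simp add: power2_eq_iff_nonneg)
  qed
  have bl: "bounded_linear t"
    by (rule bounded_linear_intro[where K = 1])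
       (simp_all add: t_add t_scale t_norm scaleR_scaleC \<sigma>_simps)
  have "y \<in> range t" for y
  proof (cases "y = 0")
    case True
    then show ?thesis using t_norm[of 0] by (metis norm_eq_zero rangeI)
  next
    case False
    obtain e c where e: "norm e = 1" "sgn y = c *\<^sub>C W e" using surj[OF norm_sgn_unit[OF False]] by blast
    have "y = of_real (norm y) *\<^sub>C sgn y"
      using False by (simp add: sgn_div_norm flip: scaleR_scaleC)
    also have "\<dots> = t (\<sigma> (of_real (norm y) * c) *\<^sub>C e)"
      by (simp only: t_scale \<sigma>_simps(4) e(2) tW[OF e(1)] scaleC_scaleC)
    finally show ?thesis by blast
  qed
  then have "surj t" by blast
  then have "semi_unitary \<sigma> (Blinfun t)"
    by (simp add: semi_unitary_def bounded_linear_Blinfun_apply[OF bl] t t_scale)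
  then show ?thesis by (rule that) (simp add: bounded_linear_Blinfun_apply[OF bl] tW)
qed

lemma semi_unitary_inverse:
  fixes T :: "'a::chilbert_space \<Rightarrow>\<^sub>L 'a"
  assumes \<sigma>: "\<sigma> = (\<lambda>z. z) \<or> \<sigma> = cnj" and T: "semi_unitary \<sigma> T"
  obtains S where "semi_unitary \<sigma> S" "\<And>x. S (T x) = x" "\<And>x. T (S x) = x"
proof -
  let ?W = "inv (blinfun_apply T)"
  have WT: "?W (T x) = x" for x by (rule inv_f_f[OF semi_unitary_inj[OF assms]])
  have TW: "T (?W x) = x" for x by (rule surj_f_inv_f[OF semi_unitaryD(3)[OF T]])
  have nW: "norm (?W x) = norm x" for x using semi_unitary_norm[OF assms, of "?W x"] TW by simp
  obtain S where S: "semi_unitary \<sigma> S" "\<And>e. norm e = 1 \<Longrightarrow> S e = ?W e"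
  proof (rule semi_unitary_extension[OF \<sigma>])
    show "cinner (?W e) (?W f) = \<sigma> (cinner e f)" for e f
      using semi_unitaryD(1)[OF T, of "?W e" "?W f"] TW \<sigma> by auto
    show "\<exists>e c. norm e = 1 \<and> g = c *\<^sub>C ?W e" if "norm g = 1" for g
      using that WT[of g] semi_unitary_norm[OF assms, of g] scaleC_one[of g] by metis
  qed blast
  have ST: "S (T x) = x" for x
  proof (cases "x = 0")
    case False
    have "S (T (sgn x)) = sgn x"
      using S(2)[of "T (sgn x)"] WT semi_unitary_norm[OF assms, of "sgn x"] False by (simp add: norm_sgn)
    then have "S (T (norm x *\<^sub>R sgn x)) = norm x *\<^sub>R sgn x" by (simp add: blinfun.scaleR_right)
    then show ?thesis using False by (simp add: sgn_div_norm)
  qed (simp add: blinfun.zero_right)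
  have "T (S x) = x" for x using ST[of "?W x"] by (simp add: TW)
  then show ?thesis using that S(1) ST by blast
qed

lemma scaled_unit: "norm x *\<^sub>R sgn x = x" for x :: "'a::real_normed_vector"
  by (cases "x = 0") (auto simp: sgn_div_norm)

text \<open>A partial isometry is determined by the rank-one partial isometries below it, that is, by its
  action on the unit vectors of its initial space; the hypothesis \<open>iff\<close> says that \<open>U\<close> and \<open>V\<close> carry those
  below \<open>S\<close> onto those below \<open>T\<close>.\<close>

lemma partial_isometry_eqI:
  fixes S T U V V' :: "'a::chilbert_space \<Rightarrow>\<^sub>L 'a"
  assumes \<sigma>: "\<sigma> = (\<lambda>z. z) \<or> \<sigma> = cnj" and U: "semi_unitary \<sigma> U" and V: "semi_unitary \<sigma> V"
    and V': "\<And>x. V (V' x) = x"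
    and S: "S \<in> partial_isometries" and T: "T \<in> partial_isometries"
    and iff: "\<And>e f. norm e = 1 \<Longrightarrow> norm f = 1 \<Longrightarrow> S f = e \<longleftrightarrow> T (V f) = U e"
  shows "T = U o\<^sub>L S o\<^sub>L V'"
proof (rule blinfun_eqI)
  fix y
  note nU = semi_unitary_norm[OF \<sigma> U] and nV = semi_unitary_norm[OF \<sigma> V]
  obtain i j where ij: "V' y = i + j" "norm (S i) = norm i" "S j = 0"
    and j: "\<And>z. norm (S z) = norm z \<Longrightarrow> cinner j z = 0"
    using partial_isometry_decompose[OF S, of "V' y"] by metis
  have "T (V i) = U (S i)"
  proof (cases "i = 0")
    case True
    then show ?thesis by (simp add: blinfun.zero_right)
  next
    case False
    have n: "norm (sgn i) = 1" "norm (S (sgn i)) = 1"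
      using False ij(2) by (simp_all add: norm_sgn sgn_div_norm blinfun.scaleR_right)
    have "T (V (sgn i)) = U (S (sgn i))" using iff[OF n(2,1)] by blast
    then have "T (V (norm i *\<^sub>R sgn i)) = U (S (norm i *\<^sub>R sgn i))" by (simp add: blinfun.scaleR_right)
    then show ?thesis by (simp add: scaled_unit)
  qed
  moreover have "T (V j) = 0"
  proof -
    obtain p q where pq: "V j = p + q" "norm (T p) = norm p" "T q = 0" "cinner q p = 0"
      using partial_isometry_decompose[OF T, of "V j"] by metis
    have "p = 0"
    proof (rule ccontr)
      assume p0: "p \<noteq> 0"
      define f where "f = V' (sgn p)"
      have f: "V f = sgn p" "norm f = 1"
        using p0 nV[of f] by (simp_all add: f_def V' norm_sgn)
      have nT: "norm (T (V f)) = 1"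
        using p0 pq(2) by (simp add: f norm_sgn sgn_div_norm blinfun.scaleR_right)
      obtain e where e: "T (V f) = U e" using semi_unitaryD(3)[OF U] by (metis surjD)
      have "norm e = 1" using nT nU[of e] by (simp add: e)
      then have "norm (S f) = norm f" using iff[OF _ f(2), of e] e f(2) by simp
      then have "cinner (V j) (V f) = 0"
        using j semi_unitaryD(1)[OF V, of j f] \<sigma> by auto
      then have "cinner (p + q) p = 0" using p0 by (simp add: f(1) pq(1) cinner_sgn_right)
      then have "cinner p p = 0" using pq(4) by (simp add: cinner_simps)
      then show False using p0 by (simp add: cinner_self)
    qed
    then show ?thesis using pq by simp
  qed
  ultimately have "T (V (V' y)) = U (S (V' y))" using ij by (simp add: blinfun.add_right)
  then show "T y = (U o\<^sub>L S o\<^sub>L V') y" by (simp add: V')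
qed

section \<open>Automorphisms of the set of partial isometries\<close>

context rank1_map
begin

lemma straight_semi_unitary:
  fixes x1 x2 x3 :: 'a
  assumes straight and b: "orthonormal3 x1 x2 x3"
  obtains U V and \<sigma> :: "complex \<Rightarrow> complex" where "\<sigma> = (\<lambda>z. z) \<or> \<sigma> = cnj"
    "\<And>e f. norm e = 1 \<Longrightarrow> norm f = 1 \<Longrightarrow> cinner (U e) (U f) = \<sigma> (cinner e f)"
    "\<And>e f. norm e = 1 \<Longrightarrow> norm f = 1 \<Longrightarrow> cinner (V e) (V f) = \<sigma> (cinner e f)"
    "\<And>g. norm g = 1 \<Longrightarrow> \<exists>e c. norm e = 1 \<and> g = c *\<^sub>C U e"
    "\<And>g. norm g = 1 \<Longrightarrow> \<exists>e c. norm e = 1 \<and> g = c *\<^sub>C V e"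
    "\<And>e f. norm e = 1 \<Longrightarrow> norm f = 1 \<Longrightarrow> \<exists>c. cmod c = 1 \<and> A e f = c *\<^sub>C U e \<and> B e f = c *\<^sub>C V f"
proof -
  obtain U V where nU: "\<And>e. norm e = 1 \<Longrightarrow> norm (U e) = 1" and nV: "\<And>f. norm f = 1 \<Longrightarrow> norm (V f) = 1"
    and AB: "\<And>e f. norm e = 1 \<Longrightarrow> norm f = 1 \<Longrightarrow> \<exists>c. cmod c = 1 \<and> A e f = c *\<^sub>C U e \<and> B e f = c *\<^sub>C V f"
    and UV: "\<And>e f. norm e = 1 \<Longrightarrow> norm f = 1 \<Longrightarrow> cinner (U e) (U f) = cinner (V e) (V f)"
    and Uorth: "\<And>e f. norm e = 1 \<Longrightarrow> norm f = 1 \<Longrightarrow> cinner (U e) (U f) = 0 \<longleftrightarrow> cinner e f = 0"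
    and gram: "\<And>e f e' f'. norm e = 1 \<Longrightarrow> norm f = 1 \<Longrightarrow> norm e' = 1 \<Longrightarrow> norm f' = 1 \<Longrightarrow>
      cinner e e' = cinner f f' \<Longrightarrow> cinner (U e) (U e') = cinner (U f) (U f')"
  proof (rule straight_factor[OF assms(1)], goal_cases)
    case (1 U V)
    show ?case by (rule 1(1)) (fact 1)+
  qed
  have onto: "\<exists>e f c. norm e = 1 \<and> norm f = 1 \<and> g = c *\<^sub>C U e \<and> g = c *\<^sub>C V f" if g: "norm g = 1" for g
  proof -
    obtain e f c where e: "norm e = 1" "norm f = 1" "cmod c = 1" "A e f = c *\<^sub>C g" "B e f = c *\<^sub>C g"
      using surj[OF g g] by blast
    obtain d where d: "A e f = d *\<^sub>C U e" "B e f = d *\<^sub>C V f" using AB[OF e(1,2)] by blast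
    have "g = (cnj c * c) *\<^sub>C g" using cnj_mult_phase[OF e(3)] by simp
    then have "g = (cnj c * d) *\<^sub>C U e" "g = (cnj c * d) *\<^sub>C V f"
      using e(4,5) d by (metis scaleC_scaleC)+
    then show ?thesis using e(1,2) by blast
  qed
  have ontoU: "\<exists>e c. norm e = 1 \<and> g = c *\<^sub>C U e" and ontoV: "\<exists>e c. norm e = 1 \<and> g = c *\<^sub>C V e"
    if "norm g = 1" for g
    using onto[OF that] by blast+
  obtain \<sigma> :: "complex \<Rightarrow> complex" where \<sigma>: "\<sigma> = (\<lambda>z. z) \<or> \<sigma> = cnj"
    and U\<sigma>: "\<And>e f. norm e = 1 \<Longrightarrow> norm f = 1 \<Longrightarrow> cinner (U e) (U f) = \<sigma> (cinner e f)"
  proof -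
    have "(\<forall>e f. norm e = 1 \<longrightarrow> norm f = 1 \<longrightarrow> cinner (U e) (U f) = cinner e f) \<or>
         (\<forall>e f. norm e = 1 \<longrightarrow> norm f = 1 \<longrightarrow> cinner (U e) (U f) = cnj (cinner e f))"
      by (rule gram_map_rigid[OF b]) (fact nU gram Uorth ontoU)+
    then show ?thesis using that[of "\<lambda>z. z"] that[of cnj] by blast
  qed
  show ?thesis
  proof (rule that[where U = U and V = V, OF \<sigma>])
    show "cinner (V e) (V f) = \<sigma> (cinner e f)" if "norm e = 1" "norm f = 1" for e f
      using U\<sigma>[OF that] UV[OF that] by simp
  qed (fact U\<sigma> ontoU ontoV AB)+
qed

end

text \<open>An order automorphism fixes the least element \<open>0\<close>, hence permutes the elements that are minimal
  among the others.\<close>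

lemma minimal_pi_automorphism:
  fixes \<phi> :: "('h::chilbert_space \<Rightarrow>\<^sub>L 'h) \<Rightarrow> ('h \<Rightarrow>\<^sub>L 'h)"
  assumes bij: "bij_betw \<phi> partial_isometries partial_isometries"
    and order: "\<And>P Q. P \<in> partial_isometries \<Longrightarrow> Q \<in> partial_isometries \<Longrightarrow>
                  pi_le P Q \<longleftrightarrow> pi_le (\<phi> P) (\<phi> Q)"
    and P: "P \<in> partial_isometries"
  shows "minimal_pi (\<phi> P) \<longleftrightarrow> minimal_pi P"
proof -
  note Z = zero_partial_isometry
  have im: "\<phi> Q \<in> partial_isometries" if "Q \<in> partial_isometries" for Q
    using bij that by (rule bij_betwE[rule_format])
  have onto: "\<exists>Q\<in>partial_isometries. R = \<phi> Q" if "R \<in> partial_isometries" for R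
    using bij_betw_imp_surj_on[OF bij] that by blast
  have inj: "\<phi> Q = \<phi> R \<longleftrightarrow> Q = R" if "Q \<in> partial_isometries" "R \<in> partial_isometries" for Q R
    using bij_betw_imp_inj_on[OF bij] that by (auto dest: inj_onD)
  obtain Q where Q: "Q \<in> partial_isometries" "0 = \<phi> Q" using onto[OF Z] by blast
  have "pi_le (\<phi> 0) (\<phi> Q)" using order[OF Z Q(1)] zero_pi_le[OF Q(1)] by simp
  then have \<phi>0: "\<phi> 0 = 0" using pi_le_antisym[OF im[OF Z] Z] zero_pi_le[OF im[OF Z]] Q(2) by simp
  have "(\<forall>R\<in>partial_isometries. pi_le R (\<phi> P) \<longrightarrow> R = 0 \<or> R = \<phi> P) \<longleftrightarrow>
      (\<forall>Q\<in>partial_isometries. pi_le (\<phi> Q) (\<phi> P) \<longrightarrow> \<phi> Q = 0 \<or> \<phi> Q = \<phi> P)"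
    using onto im by metis
  also have "\<dots> \<longleftrightarrow> (\<forall>Q\<in>partial_isometries. pi_le Q P \<longrightarrow> Q = 0 \<or> Q = P)"
    using order[OF _ P] inj[OF _ P] inj[OF _ Z] \<phi>0 by simp
  finally show ?thesis
    using P im[OF P] inj[OF P Z] \<phi>0 by (simp add: minimal_pi_def)
qed

text \<open>The rank-one operators are the minimal elements, their orthogonality is preserved by assumption,
  and having a common upper bound is a property of the order.\<close>

lemma rank1_map_of_automorphism:
  fixes \<phi> :: "('h::chilbert_space \<Rightarrow>\<^sub>L 'h) \<Rightarrow> ('h \<Rightarrow>\<^sub>L 'h)" and x1 x2 x3 :: 'h
  assumes b: "orthonormal3 x1 x2 x3"
    and bij: "bij_betw \<phi> partial_isometries partial_isometries"
    and order: "\<And>P Q. P \<in> partial_isometries \<Longrightarrow> Q \<in> partial_isometries \<Longrightarrow>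
                  pi_le P Q \<longleftrightarrow> pi_le (\<phi> P) (\<phi> Q)"
    and orth: "\<And>P Q. P \<in> partial_isometries \<Longrightarrow> Q \<in> partial_isometries \<Longrightarrow>
                  pi_orthogonal P Q \<longleftrightarrow> pi_orthogonal (\<phi> P) (\<phi> Q)"
  obtains A B where "rank1_map A B"
    "\<And>e f. norm e = 1 \<Longrightarrow> norm f = 1 \<Longrightarrow> \<phi> (rank1 e f) = rank1 (A e f) (B e f)"
proof -
  note PI = rank1_partial_isometry
  have min: "minimal_pi (\<phi> P) \<longleftrightarrow> minimal_pi P" if "P \<in> partial_isometries" for P
    by (rule minimal_pi_automorphism[OF bij _ that]) (erule (1) order)
  have "\<exists>g h. norm g = 1 \<and> norm h = 1 \<and> \<phi> (rank1 e f) = rank1 g h" if "norm e = 1" "norm f = 1" for e f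
    using min[OF PI[OF that]] minimal_pi_iff that by blast
  then obtain A B where AB: "\<And>e f. norm e = 1 \<Longrightarrow> norm f = 1 \<Longrightarrow>
      norm (A e f) = 1 \<and> norm (B e f) = 1 \<and> \<phi> (rank1 e f) = rank1 (A e f) (B e f)"
    by metis
  have "rank1_map A B"
  proof
    show "\<exists>u. norm u = 1 \<and> cinner u x = 0 \<and> cinner u y = 0" for x y :: 'h
      by (rule unit_orthogonal_to_two[OF b])
    show "norm (A e f) = 1 \<and> norm (B e f) = 1" if "norm e = 1" "norm f = 1" for e f
      using AB[OF that] by simp
    show "cinner (A e f) (A g h) = 0 \<and> cinner (B e f) (B g h) = 0 \<longleftrightarrow> cinner e g = 0 \<and> cinner f h = 0"
      if n: "norm e = 1" "norm f = 1" "norm g = 1" "norm h = 1" for e f g h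
      using orth[OF PI[OF n(1,2)] PI[OF n(3,4)]] AB[OF n(1,2)] AB[OF n(3,4)]
      by (simp add: rank1_orthogonal_iff n)
    show "cinner (A e f) (A g h) = cinner (B e f) (B g h) \<longleftrightarrow> cinner e g = cinner f h"
      if n: "norm e = 1" "norm f = 1" "norm g = 1" "norm h = 1" for e f g h
    proof -
      have "(\<exists>R\<in>partial_isometries. pi_le (rank1 (A e f) (B e f)) R \<and> pi_le (rank1 (A g h) (B g h)) R)
        \<longleftrightarrow> (\<exists>R\<in>\<phi> ` partial_isometries. pi_le (\<phi> (rank1 e f)) R \<and> pi_le (\<phi> (rank1 g h)) R)"
        using AB[OF n(1,2)] AB[OF n(3,4)] bij_betw_imp_surj_on[OF bij] by simp
      also have "\<dots> \<longleftrightarrow> (\<exists>R\<in>partial_isometries. pi_le (rank1 e f) R \<and> pi_le (rank1 g h) R)"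
        using order[OF PI[OF n(1,2)]] order[OF PI[OF n(3,4)]] by auto
      finally show ?thesis
        using rank1_compatible_iff[OF n] rank1_compatible_iff[of "A e f" "B e f" "A g h" "B g h"]
          AB[OF n(1,2)] AB[OF n(3,4)] by blast
    qed
    show "\<exists>e f c. norm e = 1 \<and> norm f = 1 \<and> cmod c = 1 \<and> A e f = c *\<^sub>C x \<and> B e f = c *\<^sub>C y"
      if n: "norm x = 1" "norm y = 1" for x y
    proof -
      obtain P where P: "P \<in> partial_isometries" "rank1 x y = \<phi> P"
        using PI[OF n] bij_betw_imp_surj_on[OF bij] by blast
      have "minimal_pi (rank1 x y)" using minimal_pi_iff n by blast
      then have "minimal_pi P" using P min by simp
      then obtain e f where ef: "norm e = 1" "norm f = 1" "P = rank1 e f" using minimal_pi_iff by blast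
      then have "rank1 (A e f) (B e f) = rank1 x y" using AB[OF ef(1,2)] P by simp
      then show ?thesis using rank1_eq_iff[of "A e f" "B e f" x y] AB[OF ef(1,2)] n ef(1,2) by blast
    qed
  qed
  then show ?thesis using that AB by blast
qed

theorem theorem1:
  fixes \<phi> :: "('h::chilbert_space \<Rightarrow>\<^sub>L 'h) \<Rightarrow> ('h \<Rightarrow>\<^sub>L 'h)"
  assumes separable: "separable_space (euclidean :: 'h topology)"
    and dim: "hilbert_dim_ge TYPE('h) 3"
    and bij: "bij_betw \<phi> partial_isometries partial_isometries"
    and order: "\<And>P Q. P \<in> partial_isometries \<Longrightarrow> Q \<in> partial_isometries \<Longrightarrow>
                  pi_le P Q \<longleftrightarrow> pi_le (\<phi> P) (\<phi> Q)"
    and orth: "\<And>P Q. P \<in> partial_isometries \<Longrightarrow> Q \<in> partial_isometries \<Longrightarrow>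
                  pi_orthogonal P Q \<longleftrightarrow> pi_orthogonal (\<phi> P) (\<phi> Q)"
    and cont: "\<exists>R\<^sub>0\<in>partial_isometries. R\<^sub>0 \<noteq> 0 \<and> continuous (at R\<^sub>0 within partial_isometries) \<phi>"
  shows
    "(\<exists>U V. unitary U \<and> unitary V \<and> (\<forall>R\<in>partial_isometries. \<phi> R = U o\<^sub>L R o\<^sub>L V)) \<or>
     (\<exists>U V. antiunitary U \<and> antiunitary V \<and> (\<forall>R\<in>partial_isometries. \<phi> R = U o\<^sub>L R o\<^sub>L V)) \<or>
     (\<exists>U V. unitary U \<and> unitary V \<and> (\<forall>R\<in>partial_isometries. \<phi> R = U o\<^sub>L hadjoint R o\<^sub>L V)) \<or>
     (\<exists>U V. antiunitary U \<and> antiunitary V \<and> (\<forall>R\<in>partial_isometries. \<phi> R = U o\<^sub>L hadjoint R o\<^sub>L V))"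
proof -
  obtain x1 x2 x3 :: 'h where b: "orthonormal3 x1 x2 x3" using orthonormal3_exists[OF dim] .
  obtain A B where M: "rank1_map A B"
    and AB: "\<And>e f. norm e = 1 \<Longrightarrow> norm f = 1 \<Longrightarrow> \<phi> (rank1 e f) = rank1 (A e f) (B e f)"
  proof (rule rank1_map_of_automorphism[OF b bij], goal_cases)
    case (3 A B)
    show ?case by (rule 3(1)) (fact 3)+
  qed (rule order orth; assumption)+
  interpret rank1_map A B by (rule M)
  interpret S: rank1_map B A by (rule swap_lines)
  have im: "\<phi> R \<in> partial_isometries" if "R \<in> partial_isometries" for R
    using bij that by (rule bij_betwE[rule_format])
  \<comment> \<open>Both cases of the conclusion: \<open>F\<close> is the identity if ranges and initial spaces keep their roles
    and the adjoint if they are exchanged.\<close>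
  have form: "\<exists>U' V'. semi_unitary \<sigma> U' \<and> semi_unitary \<sigma> V' \<and> (\<forall>R\<in>partial_isometries. \<phi> R = U' o\<^sub>L F R o\<^sub>L V')"
    if \<sigma>: "\<sigma> = (\<lambda>z. z) \<or> \<sigma> = cnj"
      and U: "semi_unitary \<sigma> U" and V: "semi_unitary \<sigma> V"
      and F: "\<And>R. R \<in> partial_isometries \<Longrightarrow> F R \<in> partial_isometries"
      and le: "\<And>R e f. R \<in> partial_isometries \<Longrightarrow> norm e = 1 \<Longrightarrow> norm f = 1 \<Longrightarrow>
        F R f = e \<longleftrightarrow> pi_le (rank1 (U e) (V f)) (\<phi> R)"
    for \<sigma> U V and F :: "('h \<Rightarrow>\<^sub>L 'h) \<Rightarrow> ('h \<Rightarrow>\<^sub>L 'h)"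
  proof -
    obtain V' where V': "semi_unitary \<sigma> V'" "\<And>x. V (V' x) = x"
    proof (rule semi_unitary_inverse[OF \<sigma> V], goal_cases)
      case (1 S)
      show ?case by (rule 1(1)) (fact 1)+
    qed
    have "\<phi> R = U o\<^sub>L F R o\<^sub>L V'" if R: "R \<in> partial_isometries" for R
    proof (rule partial_isometry_eqI[OF \<sigma> U V V'(2) F[OF R] im[OF R]])
      show "F R f = e \<longleftrightarrow> \<phi> R (V f) = U e" if "norm e = 1" "norm f = 1" for e f
        using le[OF R that] rank1_le_iff[of "U e" "V f" "\<phi> R"] im[OF R] that
          semi_unitary_norm[OF \<sigma> U] semi_unitary_norm[OF \<sigma> V] by simp
    qed
    then show ?thesis using U V'(1) by blast
  qed
  have le: "R f = e \<longleftrightarrow> pi_le (rank1 (A e f) (B e f)) (\<phi> R)"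
    if "R \<in> partial_isometries" "norm e = 1" "norm f = 1" for R e f
    using rank1_le_iff[OF that(2,3,1)] order[OF rank1_partial_isometry[OF that(2,3)] that(1)] AB[OF that(2,3)]
    by simp
  have phase: "rank1 (c *\<^sub>C g) (c *\<^sub>C h) = rank1 g h" if "cmod c = 1" for c and g h :: 'h
    using cnj_mult_phase[OF that]
    by (intro blinfun_eqI) (simp add: cinner_scaleC_right scaleC_scaleC mult.commute mult.left_commute)
  show ?thesis
    using straight_cases
  proof
    assume str: straight
    obtain u v \<sigma> where \<sigma>: "\<sigma> = (\<lambda>z. z) \<or> \<sigma> = cnj"
      and u: "\<And>e f. norm e = 1 \<Longrightarrow> norm f = 1 \<Longrightarrow> cinner (u e) (u f) = \<sigma> (cinner e f)"
      and v: "\<And>e f. norm e = 1 \<Longrightarrow> norm f = 1 \<Longrightarrow> cinner (v e) (v f) = \<sigma> (cinner e f)"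
      and onto: "\<And>g. norm g = 1 \<Longrightarrow> \<exists>e c. norm e = 1 \<and> g = c *\<^sub>C u e"
        "\<And>g. norm g = 1 \<Longrightarrow> \<exists>e c. norm e = 1 \<and> g = c *\<^sub>C v e"
      and uv: "\<And>e f. norm e = 1 \<Longrightarrow> norm f = 1 \<Longrightarrow> \<exists>c. cmod c = 1 \<and> A e f = c *\<^sub>C u e \<and> B e f = c *\<^sub>C v f"
    proof (rule straight_semi_unitary[OF str b], goal_cases)
      case (1 U V \<sigma>)
      show ?case by (rule 1(1)) (fact 1)+
    qed
    obtain U where U: "semi_unitary \<sigma> U" "\<And>e. norm e = 1 \<Longrightarrow> U e = u e"
    proof (rule semi_unitary_extension[OF \<sigma>, of u], goal_cases)
      case (3 T)
      show ?case by (rule 3(1)) (fact 3)+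
    qed (rule u onto(1); assumption)+
    obtain V where V: "semi_unitary \<sigma> V" "\<And>e. norm e = 1 \<Longrightarrow> V e = v e"
    proof (rule semi_unitary_extension[OF \<sigma>, of v], goal_cases)
      case (3 T)
      show ?case by (rule 3(1)) (fact 3)+
    qed (rule v onto(2); assumption)+
    have rank1_AB: "rank1 (A e f) (B e f) = rank1 (U e) (V f)" if "norm e = 1" "norm f = 1" for e f
      using uv[OF that] phase U(2) V(2) that by auto
    have "\<exists>U' V'. semi_unitary \<sigma> U' \<and> semi_unitary \<sigma> V' \<and> (\<forall>R\<in>partial_isometries. \<phi> R = U' o\<^sub>L R o\<^sub>L V')"
      using form[OF \<sigma> U(1) V(1), where F = "\<lambda>R. R"] le rank1_AB by simp
    then obtain U' V' where eq: "\<forall>R\<in>partial_isometries. \<phi> R = U' o\<^sub>L R o\<^sub>L V'"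
      and "unitary U' \<and> unitary V' \<or> antiunitary U' \<and> antiunitary V'"
      using semi_unitary_cases[OF \<sigma>] by blast
    then show ?thesis by blast
  next
    assume str: S.straight
    obtain u v \<sigma> where \<sigma>: "\<sigma> = (\<lambda>z. z) \<or> \<sigma> = cnj"
      and u: "\<And>e f. norm e = 1 \<Longrightarrow> norm f = 1 \<Longrightarrow> cinner (u e) (u f) = \<sigma> (cinner e f)"
      and v: "\<And>e f. norm e = 1 \<Longrightarrow> norm f = 1 \<Longrightarrow> cinner (v e) (v f) = \<sigma> (cinner e f)"
      and onto: "\<And>g. norm g = 1 \<Longrightarrow> \<exists>e c. norm e = 1 \<and> g = c *\<^sub>C u e"
        "\<And>g. norm g = 1 \<Longrightarrow> \<exists>e c. norm e = 1 \<and> g = c *\<^sub>C v e"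
      and uv: "\<And>e f. norm e = 1 \<Longrightarrow> norm f = 1 \<Longrightarrow> \<exists>c. cmod c = 1 \<and> B e f = c *\<^sub>C u e \<and> A e f = c *\<^sub>C v f"
    proof (rule S.straight_semi_unitary[OF str b], goal_cases)
      case (1 U V \<sigma>)
      show ?case by (rule 1(1)) (fact 1)+
    qed
    obtain U where U: "semi_unitary \<sigma> U" "\<And>e. norm e = 1 \<Longrightarrow> U e = u e"
    proof (rule semi_unitary_extension[OF \<sigma>, of u], goal_cases)
      case (3 T)
      show ?case by (rule 3(1)) (fact 3)+
    qed (rule u onto(1); assumption)+
    obtain V where V: "semi_unitary \<sigma> V" "\<And>e. norm e = 1 \<Longrightarrow> V e = v e"
    proof (rule semi_unitary_extension[OF \<sigma>, of v], goal_cases)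
      case (3 T)
      show ?case by (rule 3(1)) (fact 3)+
    qed (rule v onto(2); assumption)+
    have rank1_AB: "rank1 (A e f) (B e f) = rank1 (V f) (U e)" if "norm e = 1" "norm f = 1" for e f
      using uv[OF that] phase U(2) V(2) that by auto
    have "hadjoint R f = e \<longleftrightarrow> pi_le (rank1 (V e) (U f)) (\<phi> R)"
      if "R \<in> partial_isometries" "norm e = 1" "norm f = 1" for R e f
      using hadjoint_unit_iff[OF that(1,3,2)] le[OF that(1,3,2)] rank1_AB[OF that(3,2)] by simp
    then have "\<exists>U' V'. semi_unitary \<sigma> U' \<and> semi_unitary \<sigma> V' \<and>
        (\<forall>R\<in>partial_isometries. \<phi> R = U' o\<^sub>L hadjoint R o\<^sub>L V')"
      using form[OF \<sigma> V(1) U(1), where F = hadjoint] hadjoint_partial_isometry(1) by blast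
    then obtain U' V' where eq: "\<forall>R\<in>partial_isometries. \<phi> R = U' o\<^sub>L hadjoint R o\<^sub>L V'"
      and "unitary U' \<and> unitary V' \<or> antiunitary U' \<and> antiunitary V'"
      using semi_unitary_cases[OF \<sigma>] by blast
    then show ?thesis by blast
  qed
qed

end
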